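(* Let $G$ be a finitely generated group. If $G$ admits a normally aperiodic effectively closed subshift, then the complement $\overline{W(G)}$ of the word problem of $G$ is enumeration reducible to the word problem $W(G)$ of $G$, i.e. $\overline{W(G)} \leq_e W(G)$. Consequently, if $G$ is moreover finitely presented, then the word problem of $G$ is decidable.
   Context: Let $G$ be a finitely generated group given as a quotient $G=\mathbb{F}_p/R$ of the free group $\mathbb{F}_p$ on $p$ generators, with quotient map $\phi:\mathbb{F}_p\to G$; $\lambda$ denotes the identity of a group. The word problem of $G$ is $W(G)=\{g\in\mathbb{F}_p : \phi(g)=\lambda\}$, and $\overline{W(G)}=\mathbb{F}_p\setminus W(G)$. For sets $A,B$ of natural numbers (or of elements of $\mathbb{F}_p$, suitably coded), $A\leq_e B$ ($A$ is enumeration reducible to $B$) if there is a partial computable function associating to each $(n,i)$ a finite set $D_{n,i}$ such that $n\in A \iff \exists i,\ D_{n,i}\subseteq B$. Let $A$ be a finite alphabet. A word is a map $w$ from a finite subset of $\mathbb{F}_p$ to $A$. A configuration $x\in A^G$ disagrees with $w$ if there is $g$ in the domain of $w$ with $x_{\phi(g)}\neq w_g$. For a set $L$ of words, $S_L^G\subseteq A^G$ is the set of all configurations that disagree with every word of $L$. A closed set $S\subseteq A^G$ (prodiscrete topology) is effectively closed if $S=S_L^G$ for some recursively enumerable set of words $L$ (this does not depend on the choice of the finite generating set). $G$ acts on $A^G$ by $(gx)_h=x_{g^{-1}h}$. A closed set $X\subseteq A^G$ is a subshift if $gx\in X$ for all $x\in X$, $g\in G$; an effectively closed subshift is a subshift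 that is effectively closed. Let $Stab(x)=\{g\in G: gx=x\}$. A subshift $X$ is normally aperiodic if it is nonempty and for every $x\in X$ the subgroup $\bigcap_{h\in G}Stab(hx)$ is finite. "$G$ admits" such a subshift means one exists over some finite alphabet $A$. *)

theory Defs
  imports "HOL-Analysis.Analysis" "HOL-Algebra.Generated_Groups" "HOL-Algebra.Group_Action" "HOL-Library.Nat_Bijection"
begin

section \<open>Computability on the natural numbers\<close>

text \<open>
  Kleene's partial recursive functions, presented with one argument; several arguments
  are packed with the Cantor pairing \<^const>\<open>prod_encode\<close>, which is primitive recursive.
  The value \<^const>\<open>None\<close> means that the computation diverges.
\<close>

inductive partial_recursive :: "(nat \<Rightarrow> nat option) \<Rightarrow> bool" where
  zero: "partial_recursive (\<lambda>_. Some 0)"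
| succ: "partial_recursive (\<lambda>n. Some (Suc n))"
| left: "partial_recursive (\<lambda>n. Some (fst (prod_decode n)))"
| right: "partial_recursive (\<lambda>n. Some (snd (prod_decode n)))"
| pair: "partial_recursive f \<Longrightarrow> partial_recursive g \<Longrightarrow>
    partial_recursive (\<lambda>n. Option.bind (f n) (\<lambda>a. Option.bind (g n) (\<lambda>b. Some (prod_encode (a, b)))))"
| comp: "partial_recursive f \<Longrightarrow> partial_recursive g \<Longrightarrow>
    partial_recursive (\<lambda>n. Option.bind (g n) f)"
| prim_rec: "partial_recursive f \<Longrightarrow> partial_recursive g \<Longrightarrow>
    partial_recursive (\<lambda>n. case prod_decode n of (a, m) \<Rightarrow>
      rec_nat (f a) (\<lambda>k r. Option.bind r (\<lambda>v. g (prod_encode (a, prod_encode (k, v))))) m)"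
| minimize: "partial_recursive f \<Longrightarrow>
    partial_recursive (\<lambda>a.
      if \<exists>m. f (prod_encode (a, m)) = Some 0 \<and> (\<forall>k<m. f (prod_encode (a, k)) \<noteq> None)
      then Some (LEAST m. f (prod_encode (a, m)) = Some 0) else None)"

definition total_recursive :: "(nat \<Rightarrow> nat) \<Rightarrow> bool" where
  "total_recursive f \<longleftrightarrow> partial_recursive (\<lambda>n. Some (f n))"

definition recursively_enumerable :: "nat set \<Rightarrow> bool" where
  "recursively_enumerable B \<longleftrightarrow> B = {} \<or> (\<exists>f. total_recursive f \<and> B = range f)"

definition decidable :: "nat set \<Rightarrow> bool" where
  "decidable B \<longleftrightarrow> total_recursive (\<lambda>n. if n \<in> B then 1 else 0)"

text \<open>
  Finite sets are given by their canonical index (\<^const>\<open>set_decode\<close>).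
  The set \<open>D\<^sub>n\<^sub>,\<^sub>i\<close> exists only for those \<open>(n, i)\<close> on which \<open>f\<close> is defined.
\<close>

definition enumeration_reducible :: "nat set \<Rightarrow> nat set \<Rightarrow> bool" (infix \<open>\<le>\<^sub>e\<close> 50) where
  "B \<le>\<^sub>e C \<longleftrightarrow> (\<exists>f. partial_recursive f \<and>
     (\<forall>n. n \<in> B \<longleftrightarrow> (\<exists>i d. f (prod_encode (n, i)) = Some d \<and> set_decode d \<subseteq> C)))"


section \<open>Free groups\<close>

text \<open>The letter \<open>(i, True)\<close> is the \<open>i\<close>-th generator and \<open>(i, False)\<close> its inverse.\<close>

type_synonym letter = "nat \<times> bool"

definition letter_inv :: "letter \<Rightarrow> letter" where
  "letter_inv a = (fst a, \<not> snd a)"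

definition reduced :: "letter list \<Rightarrow> bool" where
  "reduced u \<longleftrightarrow> successively (\<lambda>a b. b \<noteq> letter_inv a) u"

fun cancel_cons :: "letter \<Rightarrow> letter list \<Rightarrow> letter list" where
  "cancel_cons a [] = [a]"
| "cancel_cons a (b # u) = (if b = letter_inv a then u else a # b # u)"

definition free_group :: "nat \<Rightarrow> letter list monoid" where
  "free_group p = \<lparr>carrier = {u. reduced u \<and> fst ` set u \<subseteq> {..<p}},
     mult = (\<lambda>u v. foldr cancel_cons u v), one = []\<rparr>"

definition code :: "letter list \<Rightarrow> nat" where
  "code u = list_encode (map (\<lambda>(i, b). 2 * i + of_bool b) u)"

lemma inj_code: "inj code"
proof -
  have "inj (\<lambda>(i::nat, b). 2 * i + of_bool b)"
  proof (rule injI, clarify)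
    fix i j :: nat and b c :: bool
    assume "2 * i + of_bool b = 2 * j + (of_bool c :: nat)"
    then show "i = j \<and> b = c"
      by (cases b; cases c; simp; presburger)
  qed
  then show ?thesis
    by (intro injI) (auto simp: code_def list_encode_eq dest: injD[OF inj_mapI])
qed

lemma letter_inv_inv [simp]: "letter_inv (letter_inv a) = a"
  by (simp add: letter_inv_def)

lemma reduced_cancel_cons: "reduced u \<Longrightarrow> reduced (cancel_cons a u)"
  by (cases u) (auto simp: reduced_def successively_Cons)

lemma reduced_foldr: "reduced v \<Longrightarrow> reduced (foldr cancel_cons u v)"
  by (induction u) (auto intro: reduced_cancel_cons)

lemma set_cancel_cons: "set (cancel_cons a u) \<subseteq> insert a (set u)"
  by (cases u) auto

lemma set_foldr_cancel: "set (foldr cancel_cons u v) \<subseteq> set u \<union> set v"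
proof (induction u)
  case (Cons a u)
  then show ?case using set_cancel_cons[of a "foldr cancel_cons u v"] by auto
qed simp

lemma cancel_cons_inv: "reduced u \<Longrightarrow> cancel_cons a (cancel_cons (letter_inv a) u) = u"
  by (cases u rule: remdups_adj.cases) (auto simp: reduced_def)

lemma foldr_cancel_cons:
  "reduced v \<Longrightarrow> foldr cancel_cons (cancel_cons a u) v = cancel_cons a (foldr cancel_cons u v)"
  by (cases u) (auto simp: cancel_cons_inv reduced_foldr)

lemma foldr_cancel_assoc:
  assumes "reduced v" "reduced w"
  shows "foldr cancel_cons (foldr cancel_cons u v) w = foldr cancel_cons u (foldr cancel_cons v w)"
  using assms by (induction u) (auto simp: foldr_cancel_cons reduced_foldr)

lemma foldr_cancel_left_inv:
  "reduced u \<Longrightarrow> foldr cancel_cons (rev (map letter_inv u)) u = []"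
proof (induction u)
  case (Cons a u)
  then have "reduced u" by (auto simp: reduced_def successively_Cons)
  then show ?case using Cons.IH by simp
qed simp

lemma reduced_inverse: "reduced u \<Longrightarrow> reduced (rev (map letter_inv u))"
  unfolding reduced_def successively_rev successively_map
  by (erule successively_mono) auto

theorem group_free_group: "group (free_group p)"
proof (rule groupI)
  fix x y assume "x \<in> carrier (free_group p)" "y \<in> carrier (free_group p)"
  then show "x \<otimes>\<^bsub>free_group p\<^esub> y \<in> carrier (free_group p)"
    using set_foldr_cancel[of x y] by (fastforce simp: free_group_def reduced_foldr)
next
  fix x y z
  assume "x \<in> carrier (free_group p)" "y \<in> carrier (free_group p)" "z \<in> carrier (free_group p)"
  then show "x \<otimes>\<^bsub>free_group p\<^esub> y \<otimes>\<^bsub>free_group p\<^esub> z =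
      x \<otimes>\<^bsub>free_group p\<^esub> (y \<otimes>\<^bsub>free_group p\<^esub> z)"
    by (simp add: free_group_def foldr_cancel_assoc)
next
  fix x assume x: "x \<in> carrier (free_group p)"
  show "\<exists>y\<in>carrier (free_group p). y \<otimes>\<^bsub>free_group p\<^esub> x = \<one>\<^bsub>free_group p\<^esub>"
    using x
    by (intro bexI[of _ "rev (map letter_inv x)"])
       (auto simp: free_group_def foldr_cancel_left_inv reduced_inverse letter_inv_def)
qed (auto simp: free_group_def reduced_def)


section \<open>Word problem and finite presentations\<close>

definition word_problem :: "nat \<Rightarrow> ('g, 'm) monoid_scheme \<Rightarrow> (letter list \<Rightarrow> 'g) \<Rightarrow> letter list set" where
  "word_problem p G \<phi> = kernel (free_group p) G \<phi>"

definition normal_closure :: "('g, 'm) monoid_scheme \<Rightarrow> 'g set \<Rightarrow> 'g set" where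
  "normal_closure H R = generate H {h \<otimes>\<^bsub>H\<^esub> r \<otimes>\<^bsub>H\<^esub> inv\<^bsub>H\<^esub> h | h r. h \<in> carrier H \<and> r \<in> R}"

definition finitely_presented :: "('g, 'm) monoid_scheme \<Rightarrow> bool" where
  "finitely_presented G \<longleftrightarrow> (\<exists>q \<psi> R. \<psi> \<in> epi (free_group q) G \<and>
     finite R \<and> R \<subseteq> carrier (free_group q) \<and>
     kernel (free_group q) G \<psi> = normal_closure (free_group q) R)"


section \<open>Words, configurations and subshifts\<close>

text \<open>Alphabets are finite sets of natural numbers, so that words can be coded by numbers.\<close>

definition words :: "nat \<Rightarrow> nat set \<Rightarrow> (letter list \<Rightarrow> nat option) set" where
  "words p A = {w. finite (dom w) \<and> dom w \<subseteq> carrier (free_group p) \<and> ran w \<subseteq> A}"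

definition word_code :: "(letter list \<Rightarrow> nat option) \<Rightarrow> nat" where
  "word_code w = set_encode {prod_encode (code u, a) | u a. w u = Some a}"

definition configurations :: "('g, 'm) monoid_scheme \<Rightarrow> nat set \<Rightarrow> ('g \<Rightarrow> nat) set" where
  "configurations G A = (carrier G \<rightarrow>\<^sub>E A)"

definition prodiscrete :: "('g, 'm) monoid_scheme \<Rightarrow> nat set \<Rightarrow> ('g \<Rightarrow> nat) topology" where
  "prodiscrete G A = product_topology (\<lambda>_. discrete_topology A) (carrier G)"

lemma topspace_prodiscrete: "topspace (prodiscrete G A) = configurations G A"
  by (simp add: prodiscrete_def configurations_def)

definition disagrees :: "(letter list \<Rightarrow> 'g) \<Rightarrow> ('g \<Rightarrow> nat) \<Rightarrow> (letter list \<Rightarrow> nat option) \<Rightarrow> bool" where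
  "disagrees \<phi> x w \<longleftrightarrow> (\<exists>u a. w u = Some a \<and> x (\<phi> u) \<noteq> a)"

definition avoiding :: "('g, 'm) monoid_scheme \<Rightarrow> (letter list \<Rightarrow> 'g) \<Rightarrow> nat set \<Rightarrow>
    (letter list \<Rightarrow> nat option) set \<Rightarrow> ('g \<Rightarrow> nat) set" where
  "avoiding G \<phi> A L = {x \<in> configurations G A. \<forall>w\<in>L. disagrees \<phi> x w}"

definition effectively_closed :: "nat \<Rightarrow> ('g, 'm) monoid_scheme \<Rightarrow> (letter list \<Rightarrow> 'g) \<Rightarrow> nat set \<Rightarrow>
    ('g \<Rightarrow> nat) set \<Rightarrow> bool" where
  "effectively_closed p G \<phi> A S \<longleftrightarrow> closedin (prodiscrete G A) S \<and>
     (\<exists>L \<subseteq> words p A. recursively_enumerable (word_code ` L) \<and> S = avoiding G \<phi> A L)"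

definition shift :: "('g, 'm) monoid_scheme \<Rightarrow> 'g \<Rightarrow> ('g \<Rightarrow> nat) \<Rightarrow> ('g \<Rightarrow> nat)" where
  "shift G g x = (\<lambda>h\<in>carrier G. x (inv\<^bsub>G\<^esub> g \<otimes>\<^bsub>G\<^esub> h))"

definition subshift :: "('g, 'm) monoid_scheme \<Rightarrow> nat set \<Rightarrow> ('g \<Rightarrow> nat) set \<Rightarrow> bool" where
  "subshift G A S \<longleftrightarrow> closedin (prodiscrete G A) S \<and> (\<forall>x\<in>S. \<forall>g\<in>carrier G. shift G g x \<in> S)"

definition normally_aperiodic :: "('g, 'm) monoid_scheme \<Rightarrow> ('g \<Rightarrow> nat) set \<Rightarrow> bool" where
  "normally_aperiodic G S \<longleftrightarrow> S \<noteq> {} \<and>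
     (\<forall>x\<in>S. finite (\<Inter>h\<in>carrier G. stabilizer G (shift G) (shift G h x)))"

end

theory Submission
  imports Defs
begin

text \<open>
  The idea is to recognise nontrivial elements of \<open>G\<close> by the absence of configurations with too
  much symmetry. For a configuration \<open>x\<close> let its core be the intersection of the stabilizers of all
  translates of \<open>x\<close>, a finite normal subgroup if the subshift is normally aperiodic. If all cores were trivial, then
  \<open>g\<close> would be nontrivial if and only if no \<open>x\<close> in the subshift has \<open>g\<close> in its core, and this emptiness
  can be detected by compactness. In general, compactness and Zorn's lemma yield an \<open>x\<close> with a
  maximal core \<open>K\<close> (\<open>ex_maximal_core\<close>). Now \<open>g\<close> is outside \<open>K\<close> if and only if no configuration has all of
  \<open>K\<close> and \<open>g\<close> in its core (\<open>certifies_outside_core\<close>), while for \<open>g\<close> inside the finite set \<open>K\<close>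
  a table of the nontrivial elements of \<open>K\<close> and one positive query to the word problem settle the matter
  (\<open>certifies_nontrivial\<close>).

  To compute with configurations they are lifted to colourings of all words, not necessarily reduced,
  over the generators and their inverses. Then being constant on the fibres of \<open>\<phi>\<close> and having \<open>K\<close> and \<open>g\<close> in the core are
  constraints of a single kind: inserting or deleting a relator anywhere leaves the colour
  unchanged, where the relators are the cancelling pairs, the word problem, representatives of \<open>K\<close>, and
  \<open>g\<close>. Concatenation is the only group-theoretic operation to be computed. If no colouring
  satisfies these constraints and avoids the forbidden patterns, then by Koenig's lemma there is an \<open>i\<close> such that every
  colouring of the words with code below \<open>i\<close> violates a constraint below \<open>i\<close>. This is decidable given the finite part
  of the word problem below \<open>i\<close>, which is the finite set demanded by enumeration
  reducibility (\<open>oracle_certificate\<close>).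

  For a finitely presented group the same refutation procedure, with two colours and finitely many
  relators, enumerates the word problem (\<open>certifies_finitely_presented\<close>), and a parallel search
  decides it (\<open>decidable_if_certified\<close>).
\<close>

section \<open>Recursive functions\<close>

text \<open>
  The rules collected here are syntax-directed. A function of several arguments is packed into one
  argument with the Cantor pairing; in premises about a body with bound variables, the parameter
  and the bound variables are the components of a single number \<open>t\<close>.
\<close>

named_theorems recursive_intros

definition recursive_pred :: "(nat \<Rightarrow> bool) \<Rightarrow> bool" where
  "recursive_pred P \<longleftrightarrow> total_recursive (\<lambda>n. if P n then 1 else 0)"

abbreviation (input) pfst :: "nat \<Rightarrow> nat" where "pfst n \<equiv> fst (prod_decode n)"
abbreviation (input) psnd :: "nat \<Rightarrow> nat" where "psnd n \<equiv> snd (prod_decode n)"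

lemma rec_compose: "total_recursive f \<Longrightarrow> total_recursive g \<Longrightarrow> total_recursive (\<lambda>n. f (g n))"
  unfolding total_recursive_def using partial_recursive.comp by fastforce

lemma rec_pair [recursive_intros]:
  "total_recursive f \<Longrightarrow> total_recursive g \<Longrightarrow> total_recursive (\<lambda>n. prod_encode (f n, g n))"
  unfolding total_recursive_def using partial_recursive.pair by fastforce

lemma rec_id [recursive_intros]: "total_recursive (\<lambda>n. n)"
  using partial_recursive.pair[OF partial_recursive.left partial_recursive.right]
  by (simp add: total_recursive_def)

lemma rec_fst [recursive_intros]: "total_recursive f \<Longrightarrow> total_recursive (\<lambda>n. fst (prod_decode (f n)))"
  by (rule rec_compose[of "\<lambda>n. fst (prod_decode n)"])
     (simp_all add: total_recursive_def partial_recursive.left)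

lemma rec_snd [recursive_intros]: "total_recursive f \<Longrightarrow> total_recursive (\<lambda>n. snd (prod_decode (f n)))"
  by (rule rec_compose[of "\<lambda>n. snd (prod_decode n)"])
     (simp_all add: total_recursive_def partial_recursive.right)

lemma rec_Suc [recursive_intros]: "total_recursive f \<Longrightarrow> total_recursive (\<lambda>n. Suc (f n))"
  by (rule rec_compose[of Suc]) (simp_all add: total_recursive_def partial_recursive.succ)

lemma rec_const [recursive_intros]: "total_recursive (\<lambda>n. c)"
proof (induction c)
  case 0
  show ?case by (simp add: total_recursive_def partial_recursive.zero)
next
  case (Suc c)
  then show ?case by (rule rec_Suc)
qed

lemma rec_compose2:
  assumes "total_recursive (\<lambda>t. f (pfst t) (psnd t))" "total_recursive g" "total_recursive h"
  shows "total_recursive (\<lambda>n. f (g n) (h n))"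
  using rec_compose[OF assms(1) rec_pair[OF assms(2,3)]] by simp

text \<open>
  The bodies \<open>F\<close> and \<open>G\<close> may depend on the ambient argument \<open>n\<close>: it takes the
  place of the parameter in Kleene's scheme.
\<close>

lemma rec_rec_nat [recursive_intros]:
  assumes F: "total_recursive F"
    and G: "total_recursive (\<lambda>t. G (pfst t) (pfst (psnd t)) (psnd (psnd t)))"
    and M: "total_recursive M"
  shows "total_recursive (\<lambda>n. rec_nat (F n) (\<lambda>k r. G n k r) (M n))"
proof -
  have eq: "rec_nat (Some (F a)) (\<lambda>k r. Option.bind r (\<lambda>v. Some (G a k v))) m =
      Some (rec_nat (F a) (\<lambda>k r. G a k r) m)" for a m
    by (induction m) auto
  have "total_recursive (\<lambda>t. rec_nat (F (pfst t)) (\<lambda>k r. G (pfst t) k r) (psnd t))"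
    using partial_recursive.prim_rec[OF F[unfolded total_recursive_def] G[unfolded total_recursive_def]]
    by (simp add: total_recursive_def eq case_prod_beta)
  then show ?thesis
    using rec_compose[OF _ rec_pair[OF rec_id M]] by fastforce
qed

lemma pred_compose: "recursive_pred P \<Longrightarrow> total_recursive g \<Longrightarrow> recursive_pred (\<lambda>n. P (g n))"
  unfolding recursive_pred_def by (rule rec_compose)

lemma pred_compose2:
  assumes "recursive_pred (\<lambda>t. P (pfst t) (psnd t))" "total_recursive g" "total_recursive h"
  shows "recursive_pred (\<lambda>n. P (g n) (h n))"
  using pred_compose[OF assms(1) rec_pair[OF assms(2,3)]] by simp

lemma rec_if [recursive_intros]:
  assumes "recursive_pred P" "total_recursive F" "total_recursive G"
  shows "total_recursive (\<lambda>n. if P n then F n else G n)"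
proof -
  have "total_recursive (\<lambda>n. rec_nat (G n) (\<lambda>k r. F n) (if P n then 1 else 0))"
    using assms unfolding recursive_pred_def by (intro recursive_intros rec_compose[OF assms(2)])
  also have "(\<lambda>n. rec_nat (G n) (\<lambda>k r. F n) (if P n then 1 else 0)) = (\<lambda>n. if P n then F n else G n)"
    by auto
  finally show ?thesis .
qed

lemma pred_not [recursive_intros]:
  assumes "recursive_pred P" shows "recursive_pred (\<lambda>n. \<not> P n)"
proof -
  have "total_recursive (\<lambda>n. if P n then 0 else 1)" by (intro recursive_intros assms)
  also have "(\<lambda>n. if P n then 0 else 1) = (\<lambda>n. if \<not> P n then 1 else 0)" by auto
  finally show ?thesis by (simp add: recursive_pred_def)
qed

lemma pred_True: "recursive_pred (\<lambda>n. True)" and pred_False: "recursive_pred (\<lambda>n. False)"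
  by (simp_all add: recursive_pred_def rec_const)

lemma pred_const [recursive_intros]: "recursive_pred (\<lambda>n. c)"
  by (cases c) (simp_all add: pred_True pred_False)

lemma pred_conj [recursive_intros]:
  assumes "recursive_pred P" "recursive_pred Q" shows "recursive_pred (\<lambda>n. P n \<and> Q n)"
proof -
  have "total_recursive (\<lambda>n. if P n then (if Q n then 1 else 0) else 0)"
    by (intro recursive_intros assms)
  also have "(\<lambda>n. if P n then (if Q n then 1 else 0) else 0) = (\<lambda>n. if P n \<and> Q n then 1 else 0)" by auto
  finally show ?thesis by (simp add: recursive_pred_def)
qed

lemma pred_disj [recursive_intros]:
  assumes "recursive_pred P" "recursive_pred Q" shows "recursive_pred (\<lambda>n. P n \<or> Q n)"
  using pred_not[OF pred_conj[OF pred_not[OF assms(1)] pred_not[OF assms(2)]]] by simp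

lemma pred_imp [recursive_intros]:
  assumes "recursive_pred P" "recursive_pred Q" shows "recursive_pred (\<lambda>n. P n \<longrightarrow> Q n)"
  using pred_disj[OF pred_not[OF assms(1)] assms(2)] by (simp only: imp_conv_disj)

lemma pred_eq_0: assumes "total_recursive F" shows "recursive_pred (\<lambda>n. F n = 0)"
proof -
  have "total_recursive (\<lambda>n. rec_nat 1 (\<lambda>k r. 0) (F n))" by (intro recursive_intros assms)
  also have "(\<lambda>n. rec_nat 1 (\<lambda>k r. 0) (F n)) = (\<lambda>n. if F n = 0 then 1 else (0::nat))"
  proof
    fix n show "rec_nat 1 (\<lambda>k r. 0) (F n) = (if F n = 0 then 1 else (0::nat))" by (cases "F n") auto
  qed
  finally show ?thesis by (simp add: recursive_pred_def)
qed

lemma rec_add [recursive_intros]: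
  assumes "total_recursive F" "total_recursive G" shows "total_recursive (\<lambda>n. F n + G n)"
proof -
  have "total_recursive (\<lambda>n. rec_nat (F n) (\<lambda>k r. Suc r) (G n))" by (intro recursive_intros assms)
  moreover have "rec_nat a (\<lambda>k r. Suc r) b = a + b" for a b by (induction b) auto
  ultimately show ?thesis by simp
qed

lemma rec_mult [recursive_intros]:
  assumes "total_recursive F" "total_recursive G" shows "total_recursive (\<lambda>n. F n * G n)"
proof -
  have "total_recursive (\<lambda>n. rec_nat 0 (\<lambda>k r. F n + r) (G n))"
    by (intro recursive_intros assms rec_compose[OF assms(1)])
  moreover have "rec_nat 0 (\<lambda>k r. a + r) b = a * b" for a b :: nat by (induction b) auto
  ultimately show ?thesis by simp
qed

lemma rec_power [recursive_intros]:
  assumes "total_recursive F" "total_recursive G" shows "total_recursive (\<lambda>n. F n ^ G n)"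
proof -
  have "total_recursive (\<lambda>n. rec_nat 1 (\<lambda>k r. F n * r) (G n))"
    by (intro recursive_intros assms rec_compose[OF assms(1)])
  moreover have "rec_nat 1 (\<lambda>k r. a * r) b = a ^ b" for a b :: nat by (induction b) auto
  ultimately show ?thesis by simp
qed

lemma rec_pred:
  assumes "total_recursive F" shows "total_recursive (\<lambda>n. F n - 1)"
proof -
  have "total_recursive (\<lambda>n. rec_nat 0 (\<lambda>k r. k) (F n))" by (intro recursive_intros assms)
  moreover have "rec_nat 0 (\<lambda>k r. k) b = b - 1" for b :: nat by (induction b) auto
  ultimately show ?thesis by simp
qed

lemma rec_diff [recursive_intros]:
  assumes "total_recursive F" "total_recursive G" shows "total_recursive (\<lambda>n. F n - G n)"
proof -
  have "total_recursive (\<lambda>n. rec_nat (F n) (\<lambda>k r. r - 1) (G n))" by (intro recursive_intros rec_pred assms)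
  moreover have "rec_nat a (\<lambda>k r. r - 1) b = a - b" for a b :: nat by (induction b) auto
  ultimately show ?thesis by simp
qed

lemma pred_le [recursive_intros]:
  assumes "total_recursive F" "total_recursive G" shows "recursive_pred (\<lambda>n. F n \<le> G n)"
  using pred_eq_0[OF rec_diff[OF assms]] by simp

lemma pred_less [recursive_intros]:
  assumes "total_recursive F" "total_recursive G" shows "recursive_pred (\<lambda>n. F n < G n)"
  using pred_le[OF rec_Suc[OF assms(1)] assms(2)] by (simp add: Suc_le_eq)

lemma pred_eq [recursive_intros]:
  assumes "total_recursive F" "total_recursive G" shows "recursive_pred (\<lambda>n. F n = G n)"
  using pred_conj[OF pred_le[OF assms] pred_le[OF assms(2,1)]] by (simp add: eq_iff)

lemma rec_div [recursive_intros]: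
  assumes "total_recursive F" "total_recursive G" shows "total_recursive (\<lambda>n. F n div G n)"
proof -
  \<comment> \<open>The quotient is counted up while the dividend runs through its predecessors.\<close>
  have "total_recursive (\<lambda>n. if G n = 0 then 0 else
      rec_nat 0 (\<lambda>k r. if Suc r * G n \<le> Suc k then Suc r else r) (F n))"
    by (intro recursive_intros assms rec_compose[OF assms(2)])
  moreover have "rec_nat 0 (\<lambda>k r. if Suc r * b \<le> Suc k then Suc r else r) a = a div b" if "b > 0" for a b :: nat
  proof (induction a)
    case (Suc a)
    have 1: "a div b * b \<le> a" "a < Suc (a div b) * b"
      using that by (simp_all add: div_times_less_eq_dividend dividend_less_div_times)
    have "Suc (a div b) = Suc a div b" if "Suc (a div b) * b \<le> Suc a"
      using that 1 \<open>b > 0\<close> by (intro div_nat_eqI[symmetric]) (auto simp: algebra_simps)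
    moreover have "a div b = Suc a div b" if "\<not> Suc (a div b) * b \<le> Suc a"
      using that 1 \<open>b > 0\<close> le_SucI[OF 1(1)] by (intro div_nat_eqI[symmetric]) (auto simp: algebra_simps)
    ultimately show ?case using Suc by simp
  qed simp
  then have "(if b = 0 then 0 else rec_nat 0 (\<lambda>k r. if Suc r * b \<le> Suc k then Suc r else r) a) = a div b" for a b :: nat
    by simp
  ultimately show ?thesis by (simp only:)
qed

lemma rec_mod [recursive_intros]:
  assumes "total_recursive F" "total_recursive G" shows "total_recursive (\<lambda>n. F n mod G n)"
proof -
  have "total_recursive (\<lambda>n. F n - G n * (F n div G n))" by (intro recursive_intros assms)
  then show ?thesis by (simp only: minus_mult_div_eq_mod)
qed

lemma pred_ball_less [recursive_intros]:
  assumes P: "recursive_pred (\<lambda>t. P (pfst t) (psnd t))" and M: "total_recursive M"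
  shows "recursive_pred (\<lambda>n. \<forall>k<M n. P n k)"
proof -
  have "total_recursive (\<lambda>n. rec_nat 1 (\<lambda>k r. if P n k then r else 0) (M n))"
    by (intro recursive_intros M pred_compose2[OF P])
  moreover have "rec_nat 1 (\<lambda>k r. if P n k then r else 0) m = (if \<forall>k<m. P n k then 1 else (0::nat))" for n m
    by (induction m) (auto simp: less_Suc_eq)
  ultimately show ?thesis by (simp add: recursive_pred_def)
qed

lemma pred_bex_less [recursive_intros]:
  assumes P: "recursive_pred (\<lambda>t. P (pfst t) (psnd t))" and M: "total_recursive M"
  shows "recursive_pred (\<lambda>n. \<exists>k<M n. P n k)"
proof -
  have "recursive_pred (\<lambda>n. \<not> (\<forall>k<M n. \<not> P n k))"
    by (intro recursive_intros M P)
  then show ?thesis by simp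
qed

lemma pred_bex_finite:
  assumes "finite S" "\<And>s. s \<in> S \<Longrightarrow> recursive_pred (\<lambda>n. P n s)"
  shows "recursive_pred (\<lambda>n. \<exists>s\<in>S. P n s)"
  using assms by (induction S rule: finite_induct) (auto intro!: recursive_intros)

lemma pred_in_finite:
  assumes "finite S" "total_recursive F"
  shows "recursive_pred (\<lambda>n. F n \<in> S)"
  using pred_bex_finite[OF assms(1), of "\<lambda>n s. F n = s"] assms(2)
  by (simp add: recursive_intros)

lemma pred_set_decode [recursive_intros]:
  assumes "total_recursive F" "total_recursive G"
  shows "recursive_pred (\<lambda>n. F n \<in> set_decode (G n))"
proof -
  have "recursive_pred (\<lambda>n. (G n div 2 ^ F n) mod 2 = 1)" by (intro recursive_intros assms)
  then show ?thesis by (simp add: set_decode_def odd_iff_mod_2_eq_one)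
qed

lemma rec_Least:
  assumes P: "recursive_pred (\<lambda>t. P (pfst t) (psnd t))" and ex: "\<And>n. \<exists>m. P n m"
  shows "total_recursive (\<lambda>n. LEAST m. P n m)"
proof -
  have "total_recursive (\<lambda>t. if P (pfst t) (psnd t) then 0 else 1)" by (intro recursive_intros P)
  then have "partial_recursive (\<lambda>t. Some (if P (pfst t) (psnd t) then 0 else 1))"
    by (simp add: total_recursive_def)
  from partial_recursive.minimize[OF this] show ?thesis
    unfolding total_recursive_def
    by (rule back_subst[of partial_recursive])
       (use ex in \<open>auto simp: fun_eq_iff intro!: arg_cong[of _ _ Least] split: if_splits\<close>)
qed

text \<open>
  Unbounded search is the only source of divergence: searching for an \<open>m\<close> with
  \<open>P n \<and> m = F n\<close> finds \<open>F n\<close> or runs forever.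
\<close>

lemma partial_recursive_if:
  assumes P: "recursive_pred P" and F: "total_recursive F"
  shows "partial_recursive (\<lambda>n. if P n then Some (F n) else None)"
proof -
  have "total_recursive (\<lambda>t. if P (pfst t) \<and> psnd t = F (pfst t) then 0 else 1)"
    by (intro recursive_intros pred_compose[OF P] rec_compose[OF F])
  then have "partial_recursive (\<lambda>t. Some (if P (pfst t) \<and> psnd t = F (pfst t) then 0 else 1))"
    by (simp add: total_recursive_def)
  from partial_recursive.minimize[OF this] show ?thesis
    by (rule back_subst[of partial_recursive]) (auto simp: fun_eq_iff intro!: Least_equality split: if_splits)
qed

section \<open>Codes of words\<close>

lemma length_le_list_encode: "length xs \<le> list_encode xs"
proof (induction xs)
  case (Cons x xs)
  then show ?case using le_prod_encode_2[of "list_encode xs" x] by simp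
qed simp

text \<open>
  A state consists of the remaining list and the accumulator. The code of a list bounds its length, so
  that many steps empty the list, and further steps do nothing.
\<close>

lemma rec_fold:
  assumes U: "total_recursive U" and acc: "total_recursive acc"
    and S: "total_recursive (\<lambda>t. S (pfst t) (psnd t))"
  shows "total_recursive (\<lambda>n. fold S (list_decode (U n)) (acc n))"
proof -
  define step where "step r = (if pfst r = 0 then r
    else prod_encode (psnd (pfst r - 1), S (pfst (pfst r - 1)) (psnd r)))" for r
  have step: "total_recursive step"
    unfolding step_def by (intro recursive_intros rec_pred rec_compose2[OF S])
  have "total_recursive (\<lambda>n. psnd (rec_nat (prod_encode (U n, acc n)) (\<lambda>k r. step r) (U n)))"
    by (intro recursive_intros U acc rec_compose[OF step])
  moreover have "(step ^^ m) (prod_encode (list_encode xs, a)) = prod_encode (0, fold S xs a)"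
    if "length xs \<le> m" for xs a m
    using that
  proof (induction xs arbitrary: a m)
    case Nil
    have "step (prod_encode (0, a)) = prod_encode (0, a)" by (simp add: step_def)
    then have "(step ^^ m) (prod_encode (0, a)) = prod_encode (0, a)" by (induction m) auto
    then show ?case by simp
  next
    case (Cons x xs)
    then obtain m' where m: "m = Suc m'" "length xs \<le> m'" by (cases m) auto
    have "step (prod_encode (list_encode (x # xs), a)) = prod_encode (list_encode xs, S x a)"
      by (simp add: step_def)
    then show ?case using Cons.IH[OF m(2), of "S x a"] by (simp only: m funpow_Suc_right o_apply fold_simps)
  qed
  then have "(step ^^ n) (prod_encode (n, a)) = prod_encode (0, fold S (list_decode n) a)" for n a
    using length_le_list_encode[of "list_decode n"] by (metis list_decode_inverse)
  moreover have "rec_nat x (\<lambda>k r. step r) m = (step ^^ m) x" for x m by (induction m) auto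
  ultimately show ?thesis by simp
qed

definition code_append :: "nat \<Rightarrow> nat \<Rightarrow> nat" where
  "code_append u v = list_encode (list_decode u @ list_decode v)"

lemma rec_code_append [recursive_intros]:
  assumes "total_recursive U" "total_recursive V"
  shows "total_recursive (\<lambda>n. code_append (U n) (V n))"
proof -
  have fold_cons: "fold (\<lambda>a w. Suc (prod_encode (a, w))) xs v = list_encode (rev xs @ list_decode v)" for xs v
    by (induction xs arbitrary: v) (auto simp flip: list_encode.simps)
  \<comment> \<open>Folding Cons reverses a list onto another one; doing it twice appends.\<close>
  define rv where "rv u v = fold (\<lambda>a w. Suc (prod_encode (a, w))) (list_decode u) v" for u v
  have "total_recursive (\<lambda>n. rv (rv (U n) 0) (V n))"
    unfolding rv_def by (intro rec_fold recursive_intros assms)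
  then show ?thesis by (simp add: rv_def fold_cons code_append_def)
qed

text \<open>
  Every number is the code of exactly one list of letters, reduced or not. Computations may therefore
  range over all numbers, and no word has to be reduced.
\<close>

definition decode :: "nat \<Rightarrow> letter list" where
  "decode n = map (\<lambda>k. (k div 2, odd k)) (list_decode n)"

lemma code_decode [simp]: "code (decode n) = n"
proof -
  have "(\<lambda>(i, b). 2 * i + of_bool b) \<circ> (\<lambda>k. (k div 2, odd k)) = (id :: nat \<Rightarrow> nat)"
    by (auto simp: fun_eq_iff)
  then show ?thesis by (simp add: decode_def code_def)
qed

lemma decode_code [simp]: "decode (code u) = u"
  by (rule injD[OF inj_code]) simp

lemma code_eq_iff [simp]: "code u = code v \<longleftrightarrow> u = v"
  using inj_code by (auto dest: injD)

lemma code_Nil [simp]: "code [] = 0"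
  by (simp add: code_def)

lemma code_append_code [simp]: "code_append (code u) (code v) = code (u @ v)"
  by (simp add: code_append_def code_def)

lemma le_code_append: "u \<le> code_append u v" "v \<le> code_append u v"
proof -
  have "list_encode xs \<le> list_encode (xs @ ys)" for xs ys
  proof (induction xs)
    case (Cons x xs)
    have mono: "prod_encode (x, m) \<le> prod_encode (x, n)" if "m \<le> n" for m n
    proof -
      have "triangle a \<le> triangle b" if "a \<le> b" for a b
        using that unfolding triangle_def by (intro div_le_mono mult_le_mono) auto
      then show ?thesis using that by (simp add: prod_encode_def)
    qed
    show ?case using mono[OF Cons.IH] by simp
  qed simp
  moreover have "list_encode ys \<le> list_encode (xs @ ys)" for xs ys
  proof (induction xs)
    case (Cons x xs)
    then show ?case using le_prod_encode_2[of "list_encode (xs @ ys)" x] by simp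
  qed simp
  ultimately show "u \<le> code_append u v" "v \<le> code_append u v"
    by (metis code_append_def list_decode_inverse)+
qed

lemma code_le_code_append: "code u \<le> code (u @ v)" "code v \<le> code (u @ v)"
  using le_code_append by (metis code_append_code)+

lemma not_reduced_iff: "\<not> reduced u \<longleftrightarrow> (\<exists>h a l. u = h @ [a, letter_inv a] @ l)"
proof
  assume "\<not> reduced u"
  then show "\<exists>h a l. u = h @ [a, letter_inv a] @ l"
  proof (induction u)
    case (Cons a u)
    show ?case
    proof (cases "reduced u")
      case True
      then obtain b v where "u = b # v" "b = letter_inv a"
        using Cons.prems by (cases u) (auto simp: reduced_def)
      then show ?thesis by (intro exI[of _ "[]"]) auto
    next
      case False
      then obtain h b l where "u = h @ [b, letter_inv b] @ l" using Cons.IH by blast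
      then show ?thesis by (intro exI[of _ "a # h"]) auto
    qed
  qed (simp add: reduced_def)
next
  assume "\<exists>h a l. u = h @ [a, letter_inv a] @ l"
  then show "\<not> reduced u" by (auto simp: reduced_def successively_append_iff)
qed

definition cancelling_pairs :: "nat \<Rightarrow> letter list set" where
  "cancelling_pairs p = {[a, letter_inv a] | a. fst a < p}"

lemma finite_cancelling_pairs: "finite (cancelling_pairs p)"
proof -
  have "cancelling_pairs p = (\<lambda>a. [a, letter_inv a]) ` ({..<p} \<times> UNIV)"
    by (auto simp: cancelling_pairs_def image_iff)
  then show ?thesis by simp
qed

text \<open>
  Reduced words are characterised by forbidden factors, so that membership can be decided with
  concatenation and bounded quantifiers alone.
\<close>

lemma carrier_iff:
  "u \<in> carrier (free_group p) \<longleftrightarrow> (\<forall>h a l. u = h @ [a] @ l \<longrightarrow> fst a < p) \<and>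
     (\<forall>h l. \<forall>z\<in>cancelling_pairs p. u \<noteq> h @ z @ l)"
proof -
  have 1: "fst ` set u \<subseteq> {..<p} \<longleftrightarrow> (\<forall>h a l. u = h @ [a] @ l \<longrightarrow> fst a < p)"
    by (fastforce simp: image_subset_iff in_set_conv_decomp)
  have 2: "reduced u \<longleftrightarrow> (\<forall>h l. \<forall>z\<in>cancelling_pairs p. u \<noteq> h @ z @ l)"
    if "fst ` set u \<subseteq> {..<p}"
  proof -
    have "fst a < p" if "u = h @ [a, letter_inv a] @ l" for h a l
      using \<open>fst ` set u \<subseteq> {..<p}\<close> that by auto
    then show ?thesis using not_reduced_iff[of u] unfolding cancelling_pairs_def by blast
  qed
  show ?thesis using 1 2 by (auto simp: free_group_def)
qed

lemma pred_carrier: "recursive_pred (\<lambda>n. n \<in> code ` carrier (free_group p))"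
proof -
  have "n \<in> code ` carrier (free_group p) \<longleftrightarrow>
      (\<forall>h<Suc n. \<forall>a<Suc n. \<forall>l<Suc n. code_append h (code_append (Suc (prod_encode (a, 0))) l) = n \<longrightarrow> a < 2 * p) \<and>
      (\<forall>h<Suc n. \<forall>l<Suc n. \<not> (\<exists>z\<in>code ` cancelling_pairs p. code_append h (code_append z l) = n))"
    (is "?L \<longleftrightarrow> ?A \<and> ?B") for n
  proof -
    have "?L \<longleftrightarrow> decode n \<in> carrier (free_group p)"
      by (metis code_decode decode_code image_iff)
    moreover have "?A \<longleftrightarrow> (\<forall>h a l. decode n = h @ [a] @ l \<longrightarrow> fst a < p)"
    proof -
      have sing: "Suc (prod_encode (a, 0)) = code [(a div 2, odd a)]" for a
        by (simp add: code_def)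
      show ?thesis
      proof (intro iffI allI impI)
        fix h a l assume A: ?A and n: "decode n = h @ [a] @ l"
        define k where "k = 2 * fst a + of_bool (snd a)"
        have a: "a = (k div 2, odd k)" by (simp add: k_def prod_eq_iff)
        have nc: "n = code (h @ [a] @ l)" by (metis n code_decode)
        then have "code h \<le> n" "code l \<le> n" and an: "code [a] \<le> n"
          using code_le_code_append(1)[of h "[a] @ l"] code_le_code_append(2)[of l "h @ [a]"]
            code_le_code_append(1)[of "[a]" l] code_le_code_append(2)[of "[a] @ l" h] by auto
        moreover have "k \<le> n"
          using le_prod_encode_1[of k 0] an sing[of k] unfolding a[symmetric] by simp
        moreover have "code_append (code h) (code_append (Suc (prod_encode (k, 0))) (code l)) = n"
          unfolding sing a[symmetric] by (simp add: nc)
        ultimately have "k < 2 * p" using A[rule_format, of "code h" k "code l"] by (simp only: less_Suc_eq_le)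
        then show "fst a < p" by (simp add: k_def)
      next
        fix h a l assume B: "\<forall>h a l. decode n = h @ [a] @ l \<longrightarrow> fst a < p"
          and n: "code_append h (code_append (Suc (prod_encode (a, 0))) l) = n"
        then have "code (decode h @ [(a div 2, odd a)] @ decode l) = n"
          unfolding sing by (metis code_append_code code_decode)
        then show "a < 2 * p" using B by (metis decode_code fst_conv less_mult_imp_div_less mult.commute div_less_iff_less_mult pos2)
      qed
    qed
    moreover have "?B \<longleftrightarrow> (\<forall>h l. \<forall>z\<in>cancelling_pairs p. decode n \<noteq> h @ z @ l)"
    proof (intro iffI allI ballI notI impI)
      fix h l z assume B: ?B and z: "z \<in> cancelling_pairs p" and n: "decode n = h @ z @ l"
      then have nc: "n = code (h @ z @ l)" by (metis code_decode)
      then have "code h \<le> n" "code l \<le> n" "code_append (code h) (code_append (code z) (code l)) = n"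
        using code_le_code_append(1)[of h "z @ l"] code_le_code_append(2)[of l "h @ z"] by auto
      then show False using B[rule_format, of "code h" "code l"] z by (simp only: less_Suc_eq_le) blast
    next
      fix h l assume B: "\<forall>h l. \<forall>z\<in>cancelling_pairs p. decode n \<noteq> h @ z @ l"
        and "\<exists>z\<in>code ` cancelling_pairs p. code_append h (code_append z l) = n"
      then obtain z where z: "z \<in> cancelling_pairs p" "code_append h (code_append (code z) l) = n" by blast
      then have "code (decode h @ z @ decode l) = n" by (metis code_append_code code_decode)
      then show False using B z by (metis decode_code)
    qed
    ultimately show ?thesis by (simp add: carrier_iff)
  qed
  then show ?thesis
    by (simp only:) (intro recursive_intros pred_bex_finite finite_imageI finite_cancelling_pairs)
qed

section \<open>Invariant colourings\<close>

text \<open>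
  A colouring of all words over the letters factors through the monoid with relators \<open>Z\<close>
  precisely if inserting or deleting a relator does not change the colour.
\<close>

definition invariant_under :: "letter list set \<Rightarrow> (letter list \<Rightarrow> nat) \<Rightarrow> bool" where
  "invariant_under Z Y \<longleftrightarrow> (\<forall>h l. \<forall>z\<in>Z. Y (h @ z @ l) = Y (h @ l))"

text \<open>
  A violation of invariance that lives on the words with code below \<open>i\<close>. The parameter \<open>i\<close> bounds
  everything, which makes the condition decidable and dependent on finitely many relators only.
\<close>

definition clash :: "nat set \<Rightarrow> nat \<Rightarrow> (nat \<Rightarrow> nat) \<Rightarrow> bool" where
  "clash Z i y \<longleftrightarrow> (\<exists>h<i. \<exists>z<i. \<exists>l<i. z \<in> Z \<and> code_append h (code_append z l) < i \<and> code_append h l < i \<and>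
     y (code_append h (code_append z l)) \<noteq> y (code_append h l))"

lemma clash_local: "(\<And>k. k < i \<Longrightarrow> y k = y' k) \<Longrightarrow> clash Z i y \<Longrightarrow> clash Z i y'"
  unfolding clash_def by metis

lemma clash_mono: "i \<le> j \<Longrightarrow> Z \<inter> {..<i} \<subseteq> Z' \<Longrightarrow> clash Z i y \<Longrightarrow> clash Z' j y"
  unfolding clash_def by (meson IntI lessThan_iff less_le_trans subsetD)

lemma clash_iff: "(\<exists>i. clash Z i y) \<longleftrightarrow> \<not> invariant_under (decode ` Z) (\<lambda>u. y (code u))"
proof
  assume "\<exists>i. clash Z i y"
  then obtain h z l where "z \<in> Z" "y (code_append h (code_append z l)) \<noteq> y (code_append h l)"
    unfolding clash_def by blast
  then have "y (code (decode h @ decode z @ decode l)) \<noteq> y (code (decode h @ decode l))"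
    by (simp flip: code_append_code)
  then show "\<not> invariant_under (decode ` Z) (\<lambda>u. y (code u))"
    unfolding invariant_under_def using \<open>z \<in> Z\<close> by blast
next
  assume "\<not> invariant_under (decode ` Z) (\<lambda>u. y (code u))"
  then obtain h z l where z: "z \<in> Z" "y (code (h @ decode z @ l)) \<noteq> y (code (h @ l))"
    unfolding invariant_under_def by blast
  define i where "i = Suc (code h + z + code l + code (h @ decode z @ l) + code (h @ l))"
  have "code_append (code h) (code_append z (code l)) = code (h @ decode z @ l)"
    by (metis code_append_code code_decode)
  then have "clash Z i y" unfolding clash_def using z
    by (intro exI[of _ "code h"] exI[of _ z] exI[of _ "code l"] conjI) (simp_all add: i_def)
  then show "\<exists>i. clash Z i y" ..
qed

lemma pred_clash:
  assumes Z: "recursive_pred (\<lambda>t. pfst t \<in> Z (psnd t))"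
    and y: "total_recursive (\<lambda>t. y (pfst t) (psnd t))" and I: "total_recursive I"
  shows "recursive_pred (\<lambda>n. clash (Z n) (I n) (y n))"
  unfolding clash_def
  by (intro recursive_intros I rec_compose[OF I] pred_compose2[OF Z] rec_compose2[OF y])

text \<open>
  Compactness of the space of colourings with \<open>B\<close> colours, by Koenig's lemma: if no stage \<open>i\<close> refutes
  all colourings, then some list of initial values can be extended one value at a time such that
  the extensions still escape refutation at every stage, and the limit is never refuted.
\<close>

lemma koenig:
  fixes P :: "nat \<Rightarrow> (nat \<Rightarrow> nat) \<Rightarrow> bool"
  assumes loc: "\<And>i y y'. (\<And>k. k < i \<Longrightarrow> y k = y' k) \<Longrightarrow> P i y \<Longrightarrow> P i y'"
    and mono: "\<And>i j y. i \<le> j \<Longrightarrow> P i y \<Longrightarrow> P j y"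
    and all: "\<And>y. (\<And>k. y k < B) \<Longrightarrow> \<exists>i. P i y"
  shows "\<exists>i. \<forall>y. (\<forall>k. y k < B) \<longrightarrow> P i y"
proof (rule ccontr)
  assume neg: "\<nexists>i. \<forall>y. (\<forall>k. y k < B) \<longrightarrow> P i y"
  define good where "good t \<longleftrightarrow> (\<forall>i. \<exists>y. (\<forall>k. y k < B) \<and> (\<forall>k<length t. y k = t ! k) \<and> \<not> P i y)" for t
  have good0: "good []" using neg by (auto simp: good_def)
  have step: "\<exists>b. good (t @ [b])" if t: "good t" for t
  proof (rule ccontr)
    assume "\<nexists>b. good (t @ [b])"
    then have "\<forall>b. \<exists>i. \<forall>y. (\<forall>k. y k < B) \<longrightarrow> (\<forall>k<length (t @ [b]). y k = (t @ [b]) ! k) \<longrightarrow> P i y"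
      unfolding good_def by blast
    then obtain i where i: "\<And>b y. (\<forall>k. y k < B) \<Longrightarrow> (\<forall>k<length (t @ [b]). y k = (t @ [b]) ! k) \<Longrightarrow> P (i b) y"
      by metis
    obtain y where y: "\<forall>k. y k < B" "\<forall>k<length t. y k = t ! k" "\<not> P (\<Sum>b<B. i b) y"
      using t unfolding good_def by blast
    have "P (i (y (length t))) y" using y by (intro i) (auto simp: nth_append less_Suc_eq)
    moreover have "i (y (length t)) \<le> (\<Sum>b<B. i b)" using y(1) by (intro member_le_sum) auto
    ultimately show False using y(3) mono by blast
  qed
  define T where "T = rec_nat [] (\<lambda>n t. t @ [SOME b. good (t @ [b])])"
  have good: "good (T n)" for n
    by (induction n) (auto simp: T_def good0 intro: someI_ex[OF step])
  have len: "length (T n) = n" for n by (induction n) (auto simp: T_def)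
  define y where "y k = T (Suc k) ! k" for k
  have T: "T n ! k = y k" if "k < n" for n k
    using that
  proof (induction n)
    case (Suc n)
    have "T (Suc n) = T n @ [SOME b. good (T n @ [b])]" by (simp add: T_def)
    then show ?case using Suc by (cases "k = n") (auto simp: y_def nth_append len)
  qed simp
  have "\<not> P i y" for i
  proof -
    obtain y' where "\<forall>k<i. y' k = T i ! k" "\<not> P i y'"
      using good[of i] unfolding good_def len by blast
    then show ?thesis using loc[of i y y'] T by auto
  qed
  moreover have "y k < B" for k
  proof -
    obtain y' where "\<forall>k. y' k < B" "\<forall>j<Suc k. y' j = T (Suc k) ! j"
      using good[of "Suc k"] by (auto simp: good_def len)
    then show ?thesis by (metis lessI y_def)
  qed
  ultimately show False using all by blast
qed

definition digit :: "nat \<Rightarrow> nat \<Rightarrow> nat \<Rightarrow> nat" where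
  "digit B \<sigma> k = \<sigma> div B ^ k mod B"

lemma ex_digits:
  assumes "\<And>k. y k < B"
  shows "\<exists>\<sigma><B ^ i. \<forall>k<i. digit B \<sigma> k = y k"
proof (induction i)
  case (Suc i)
  then obtain \<sigma> where s: "\<sigma> < B ^ i" "\<forall>k<i. digit B \<sigma> k = y k" by blast
  define \<tau> where "\<tau> = \<sigma> + y i * B ^ i"
  have "B > 0" using assms by (metis gr_zeroI not_less_zero)
  have "\<tau> < B ^ i + y i * B ^ i" using s by (simp add: \<tau>_def)
  also have "\<dots> = Suc (y i) * B ^ i" by simp
  also have "\<dots> \<le> B * B ^ i" using assms[of i] by (intro mult_le_mono1) simp
  finally have "\<tau> < B ^ Suc i" by simp
  moreover have "digit B \<tau> k = y k" if "k < Suc i" for k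
  proof (cases "k = i")
    case True
    then show ?thesis using s(1) assms[of i] \<open>B > 0\<close> by (simp add: digit_def \<tau>_def)
  next
    case False
    then have "k < i" using that by simp
    then obtain d where i: "i = k + Suc d" by (auto dest: less_imp_Suc_add)
    have "\<tau> = \<sigma> + (y i * B ^ d * B) * B ^ k" by (simp add: \<tau>_def i power_add)
    then have "\<tau> div B ^ k = \<sigma> div B ^ k + y i * B ^ d * B" using \<open>B > 0\<close> by simp
    then have "digit B \<tau> k = digit B \<sigma> k" by (simp add: digit_def)
    then show ?thesis using s(2) \<open>k < i\<close> by simp
  qed
  ultimately show ?case by blast
qed simp

text \<open>
  The colourings of \<open>{..<i}\<close> are the base-\<open>B\<close> digit sequences of the numbers below \<open>B ^ i\<close>. This
  turns a quantifier over colourings into a bounded quantifier over numbers.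
\<close>

lemma colouring_certificate:
  fixes P :: "nat \<Rightarrow> (nat \<Rightarrow> nat) \<Rightarrow> bool"
  assumes "\<And>i y y'. (\<And>k. k < i \<Longrightarrow> y k = y' k) \<Longrightarrow> P i y \<Longrightarrow> P i y'"
    and "\<And>i j y. i \<le> j \<Longrightarrow> P i y \<Longrightarrow> P j y" and "B > 0"
  shows "(\<forall>y. (\<forall>k. y k < B) \<longrightarrow> (\<exists>i. P i y)) \<longleftrightarrow> (\<exists>i. \<forall>\<sigma><B ^ i. P i (digit B \<sigma>))"
proof
  assume all: "\<forall>y. (\<forall>k. y k < B) \<longrightarrow> (\<exists>i. P i y)"
  have "\<exists>i. \<forall>y. (\<forall>k. y k < B) \<longrightarrow> P i y"
    by (rule koenig) (fact assms(1), fact assms(2), use all in blast)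
  moreover have "digit B \<sigma> k < B" for \<sigma> k using \<open>B > 0\<close> by (simp add: digit_def)
  ultimately show "\<exists>i. \<forall>\<sigma><B ^ i. P i (digit B \<sigma>)" by blast
next
  assume "\<exists>i. \<forall>\<sigma><B ^ i. P i (digit B \<sigma>)"
  then obtain i where i: "\<And>\<sigma>. \<sigma> < B ^ i \<Longrightarrow> P i (digit B \<sigma>)" by blast
  show "\<forall>y. (\<forall>k. y k < B) \<longrightarrow> (\<exists>i. P i y)"
  proof (intro allI impI exI)
    fix y :: "nat \<Rightarrow> nat" assume "\<forall>k. y k < B"
    then obtain \<sigma> where s: "\<sigma> < B ^ i" "\<forall>k<i. digit B \<sigma> k = y k" using ex_digits by metis
    show "P i y" by (rule assms(1)[OF _ i[OF s(1)]]) (use s(2) in simp)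
  qed
qed

section \<open>Words in groups\<close>

definition eval_word :: "('g, 'm) monoid_scheme \<Rightarrow> (letter \<Rightarrow> 'g) \<Rightarrow> letter list \<Rightarrow> 'g" where
  "eval_word G m u = foldr (\<lambda>a g. m a \<otimes>\<^bsub>G\<^esub> g) u \<one>\<^bsub>G\<^esub>"

lemma eval_word_Nil [simp]: "eval_word G m [] = \<one>\<^bsub>G\<^esub>"
  and eval_word_Cons [simp]: "eval_word G m (a # u) = m a \<otimes>\<^bsub>G\<^esub> eval_word G m u"
  by (simp_all add: eval_word_def)

lemma free_group_simps [simp]:
  "mult (free_group p) = foldr cancel_cons" "one (free_group p) = []"
  by (auto simp: free_group_def fun_eq_iff)

lemma carrier_free_group: "u \<in> carrier (free_group p) \<longleftrightarrow> reduced u \<and> fst ` set u \<subseteq> {..<p}"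
  by (simp add: free_group_def)

lemma Nil_carrier [simp]: "[] \<in> carrier (free_group p)"
  and letter_carrier [simp]: "[a] \<in> carrier (free_group p) \<longleftrightarrow> fst a < p"
  and Cons_carrierD: "a # u \<in> carrier (free_group p) \<Longrightarrow> fst a < p \<and> u \<in> carrier (free_group p)"
  by (auto simp: carrier_free_group reduced_def successively_Cons)

lemma fst_letter_inv [simp]: "fst (letter_inv a) = fst a"
  by (simp add: letter_inv_def)

lemma reduce_carrier:
  assumes "fst ` set u \<subseteq> {..<p}" "v \<in> carrier (free_group p)"
  shows "foldr cancel_cons u v \<in> carrier (free_group p)"
  using assms set_foldr_cancel[of u v] by (fastforce simp: carrier_free_group reduced_foldr)

definition word_inv :: "letter list \<Rightarrow> letter list" where
  "word_inv u = rev (map letter_inv u)"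

lemma word_inv_inv [simp]: "word_inv (word_inv u) = u"
  by (simp add: word_inv_def rev_map o_def)

lemma fst_word_inv [simp]: "fst ` set (word_inv u) = fst ` set u"
  by (simp add: word_inv_def image_image)

lemma inv_free_group:
  assumes "u \<in> carrier (free_group p)"
  shows "inv\<^bsub>free_group p\<^esub> u = word_inv u" "word_inv u \<in> carrier (free_group p)"
proof -
  interpret F: group "free_group p" by (rule group_free_group)
  show c: "word_inv u \<in> carrier (free_group p)"
    using assms reduced_inverse[of u] by (simp add: carrier_free_group fst_word_inv) (simp add: word_inv_def)
  show "inv\<^bsub>free_group p\<^esub> u = word_inv u"
    using assms c foldr_cancel_left_inv[of u]
    by (intro F.inv_equality) (auto simp: carrier_free_group word_inv_def)
qed

context
  fixes G :: "('g, 'm) monoid_scheme" and m :: "letter \<Rightarrow> 'g"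
  assumes group: "group G" and m: "\<And>a. m a \<in> carrier G"
    and minv: "\<And>a. m (letter_inv a) = inv\<^bsub>G\<^esub> (m a)"
begin

interpretation group G by (rule group)

lemma eval_word_closed [simp]: "eval_word G m u \<in> carrier G"
  using m by (induction u) auto

lemma eval_word_append [simp]: "eval_word G m (u @ v) = eval_word G m u \<otimes>\<^bsub>G\<^esub> eval_word G m v"
  using m by (induction u) (auto simp: m_assoc)

lemma eval_word_inv [simp]: "eval_word G m (word_inv u) = inv\<^bsub>G\<^esub> (eval_word G m u)"
  using m by (induction u) (auto simp: word_inv_def minv inv_mult_group)

lemma eval_word_reduce:
  "eval_word G m (foldr cancel_cons u v) = eval_word G m u \<otimes>\<^bsub>G\<^esub> eval_word G m v"
proof -
  have "eval_word G m (cancel_cons a w) = m a \<otimes>\<^bsub>G\<^esub> eval_word G m w" for a w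
    using minv[of a] m by (cases w) (auto simp flip: m_assoc)
  then show ?thesis using m by (induction u) (auto simp: m_assoc)
qed

end

lemma hom_letter_inv:
  assumes "group G" "\<phi> \<in> hom (free_group p) G" "fst a < p"
  shows "\<phi> [letter_inv a] = inv\<^bsub>G\<^esub> (\<phi> [a])"
proof -
  interpret group_hom "free_group p" G \<phi>
    using assms by (simp add: group_hom_def group_hom_axioms_def group_free_group)
  show ?thesis using hom_inv[of "[a]"] inv_free_group[of "[a]" p] assms(3)
    by (simp add: word_inv_def)
qed

lemma hom_eq_eval_word:
  assumes "group G" "\<phi> \<in> hom (free_group p) G" "\<And>a. fst a < p \<Longrightarrow> m a = \<phi> [a]"
    and "u \<in> carrier (free_group p)"
  shows "eval_word G m u = \<phi> u"
  using assms(4)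
proof (induction u)
  case Nil
  then show ?case using hom_one[OF assms(2) group_free_group assms(1)] by simp
next
  case (Cons a u)
  then have a: "fst a < p" "u \<in> carrier (free_group p)" by (auto dest: Cons_carrierD)
  have "cancel_cons a u = a # u"
    using Cons.prems by (cases u) (auto simp: carrier_free_group reduced_def)
  then have "\<phi> (a # u) = \<phi> [a] \<otimes>\<^bsub>G\<^esub> \<phi> u"
    using hom_mult[OF assms(2), of "[a]" u] a by simp
  then show ?case using Cons.IH a assms(3) by simp
qed

section \<open>Interchangeable words\<close>

text \<open>
  The syntactic congruence of a colouring: words that can replace each other in every context
  without changing the colour. Relators become interchangeable with the empty word, and invariance can be
  argued with by calculation in a monoid.
\<close>

definition interchangeable :: "(letter list \<Rightarrow> nat) \<Rightarrow> letter list \<Rightarrow> letter list \<Rightarrow> bool" where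
  "interchangeable Y u v \<longleftrightarrow> (\<forall>h l. Y (h @ u @ l) = Y (h @ v @ l))"

lemma interchangeable_refl [simp]: "interchangeable Y u u"
  and interchangeable_sym: "interchangeable Y u v \<Longrightarrow> interchangeable Y v u"
  and interchangeable_trans [trans]:
    "interchangeable Y u v \<Longrightarrow> interchangeable Y v w \<Longrightarrow> interchangeable Y u w"
  by (simp_all add: interchangeable_def)

lemma interchangeable_append:
  assumes "interchangeable Y u u'" "interchangeable Y v v'"
  shows "interchangeable Y (u @ v) (u' @ v')"
  unfolding interchangeable_def
proof (intro allI)
  fix h l
  have "Y (h @ (u @ v) @ l) = Y (h @ u' @ (v @ l))" using assms(1) by (simp add: interchangeable_def)
  also have "\<dots> = Y ((h @ u') @ v' @ l)" using assms(2) unfolding interchangeable_def by (metis append_assoc)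
  finally show "Y (h @ (u @ v) @ l) = Y (h @ (u' @ v') @ l)" by simp
qed

lemma interchangeableD: "interchangeable Y u v \<Longrightarrow> Y u = Y v"
  unfolding interchangeable_def by (metis append_Nil append_Nil2)

lemma invariant_under_iff: "invariant_under Z Y \<longleftrightarrow> (\<forall>z\<in>Z. interchangeable Y z [])"
  by (auto simp: invariant_under_def interchangeable_def)

context
  fixes Y :: "letter list \<Rightarrow> nat" and p :: nat
  assumes inv: "invariant_under (cancelling_pairs p) Y"
begin

lemma interchangeable_pair: "fst a < p \<Longrightarrow> interchangeable Y [a, letter_inv a] []"
  using inv unfolding invariant_under_iff cancelling_pairs_def by blast

lemma interchangeable_reduce:
  assumes "fst ` set u \<subseteq> {..<p}"
  shows "interchangeable Y (foldr cancel_cons u v) (u @ v)"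
proof -
  have "interchangeable Y (cancel_cons a w) ([a] @ w)" if "fst a < p" for a w
  proof (cases w)
    case (Cons b w')
    show ?thesis
    proof (cases "b = letter_inv a")
      case True
      then show ?thesis
        using interchangeable_append[OF interchangeable_pair[OF that] interchangeable_refl, of w'] Cons
        by (auto intro: interchangeable_sym)
    qed (simp add: Cons)
  qed simp
  then show ?thesis using assms
  proof (induction u)
    case (Cons a u)
    have "interchangeable Y (foldr cancel_cons (a # u) v) ([a] @ foldr cancel_cons u v)"
      using Cons.prems by simp
    also have "interchangeable Y \<dots> ([a] @ u @ v)"
      using Cons by (intro interchangeable_append interchangeable_refl) auto
    finally show ?case by simp
  qed simp
qed

lemma interchangeable_inv: "fst ` set u \<subseteq> {..<p} \<Longrightarrow> interchangeable Y (word_inv u @ u) []"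
proof (induction u)
  case (Cons a u)
  have "interchangeable Y (word_inv u @ [letter_inv a, a] @ u) (word_inv u @ [] @ u)"
    using interchangeable_pair[of "letter_inv a"] Cons.prems
    by (intro interchangeable_append interchangeable_refl) auto
  also have "interchangeable Y (word_inv u @ [] @ u) []" using Cons by simp
  finally show ?case by (simp add: word_inv_def)
qed (simp add: word_inv_def)

lemma interchangeable_inv': "fst ` set u \<subseteq> {..<p} \<Longrightarrow> interchangeable Y (u @ word_inv u) []"
  using interchangeable_inv[of "word_inv u"] by simp

lemma interchangeable_if_kernel:
  assumes "interchangeable Y (foldr cancel_cons (word_inv u) v) []"
    and u: "fst ` set u \<subseteq> {..<p}"
  shows "interchangeable Y u v"
proof -
  have "interchangeable Y (u @ []) (u @ foldr cancel_cons (word_inv u) v)"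
    by (intro interchangeable_append interchangeable_refl interchangeable_sym[OF assms(1)])
  also have "interchangeable Y \<dots> (u @ word_inv u @ v)"
    using u by (intro interchangeable_append interchangeable_refl interchangeable_reduce) simp
  also have "interchangeable Y \<dots> ([] @ v)"
    using interchangeable_append[OF interchangeable_inv'[OF u] interchangeable_refl, of v] by simp
  finally show ?thesis by simp
qed

end

lemma kernel_if_equal_images:
  assumes "group G" "\<phi> \<in> hom (free_group p) G"
    and u: "u \<in> carrier (free_group p)" and v: "v \<in> carrier (free_group p)" and eq: "\<phi> u = \<phi> v"
  shows "foldr cancel_cons (word_inv u) v \<in> word_problem p G \<phi>"
proof -
  interpret group_hom "free_group p" G \<phi>
    using assms by (simp add: group_hom_def group_hom_axioms_def group_free_group)
  have "inv\<^bsub>free_group p\<^esub> u \<otimes>\<^bsub>free_group p\<^esub> v \<in> carrier (free_group p)"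
    using u v by (intro G.m_closed G.inv_closed)
  moreover have "\<phi> (inv\<^bsub>free_group p\<^esub> u \<otimes>\<^bsub>free_group p\<^esub> v) = \<one>\<^bsub>G\<^esub>"
    using u v eq hom_mult[of "inv\<^bsub>free_group p\<^esub> u" v] hom_inv[of u] by (simp del: free_group_simps)
  ultimately show ?thesis
    using inv_free_group[OF u] by (simp add: word_problem_def kernel_def)
qed

section \<open>Cores of stabilizers\<close>

text \<open>
  For a configuration \<open>x\<close> this is the largest normal subgroup of \<open>G\<close> inside the stabilizer of \<open>x\<close>. Its elements can be
  deleted anywhere in a product without affecting the letter of \<open>x\<close> at that place.
\<close>

definition core :: "('g, 'm) monoid_scheme \<Rightarrow> ('g \<Rightarrow> nat) \<Rightarrow> 'g set" where
  "core G x = (\<Inter>h\<in>carrier G. stabilizer G (shift G) (shift G h x))"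

lemma core_iff:
  assumes "group G"
  shows "k \<in> core G x \<longleftrightarrow> k \<in> carrier G \<and>
    (\<forall>h\<in>carrier G. \<forall>l\<in>carrier G. x (h \<otimes>\<^bsub>G\<^esub> k \<otimes>\<^bsub>G\<^esub> l) = x (h \<otimes>\<^bsub>G\<^esub> l))"
proof -
  interpret group G by fact
  have fix_iff: "shift G k (shift G h x) = shift G h x \<longleftrightarrow>
      (\<forall>l\<in>carrier G. x (inv\<^bsub>G\<^esub> h \<otimes>\<^bsub>G\<^esub> k \<otimes>\<^bsub>G\<^esub> l) = x (inv\<^bsub>G\<^esub> h \<otimes>\<^bsub>G\<^esub> l))"
    if k: "k \<in> carrier G" and h: "h \<in> carrier G" for h
  proof -
    have "shift G k (shift G h x) = shift G h x \<longleftrightarrow>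
        (\<forall>l\<in>carrier G. x (inv\<^bsub>G\<^esub> h \<otimes>\<^bsub>G\<^esub> (inv\<^bsub>G\<^esub> k \<otimes>\<^bsub>G\<^esub> l)) = x (inv\<^bsub>G\<^esub> h \<otimes>\<^bsub>G\<^esub> l))"
      using k by (auto simp: shift_def fun_eq_iff restrict_def)
    also have "\<dots> \<longleftrightarrow> (\<forall>l\<in>carrier G. x (inv\<^bsub>G\<^esub> h \<otimes>\<^bsub>G\<^esub> k \<otimes>\<^bsub>G\<^esub> l) = x (inv\<^bsub>G\<^esub> h \<otimes>\<^bsub>G\<^esub> l))"
    proof (intro iffI ballI)
      fix l assume "\<forall>l\<in>carrier G. x (inv\<^bsub>G\<^esub> h \<otimes>\<^bsub>G\<^esub> (inv\<^bsub>G\<^esub> k \<otimes>\<^bsub>G\<^esub> l)) = x (inv\<^bsub>G\<^esub> h \<otimes>\<^bsub>G\<^esub> l)" "l \<in> carrier G"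
      then show "x (inv\<^bsub>G\<^esub> h \<otimes>\<^bsub>G\<^esub> k \<otimes>\<^bsub>G\<^esub> l) = x (inv\<^bsub>G\<^esub> h \<otimes>\<^bsub>G\<^esub> l)"
        using k h by (elim ballE[of _ _ "k \<otimes>\<^bsub>G\<^esub> l"]) (auto simp flip: m_assoc simp: r_inv l_inv)
    next
      fix l assume eq: "\<forall>l\<in>carrier G. x (inv\<^bsub>G\<^esub> h \<otimes>\<^bsub>G\<^esub> k \<otimes>\<^bsub>G\<^esub> l) = x (inv\<^bsub>G\<^esub> h \<otimes>\<^bsub>G\<^esub> l)" and l: "l \<in> carrier G"
      have "inv\<^bsub>G\<^esub> h \<otimes>\<^bsub>G\<^esub> k \<otimes>\<^bsub>G\<^esub> (inv\<^bsub>G\<^esub> k \<otimes>\<^bsub>G\<^esub> l) = inv\<^bsub>G\<^esub> h \<otimes>\<^bsub>G\<^esub> l"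
        using k h l by (metis inv_closed inv_solve_left m_assoc m_closed)
      then show "x (inv\<^bsub>G\<^esub> h \<otimes>\<^bsub>G\<^esub> (inv\<^bsub>G\<^esub> k \<otimes>\<^bsub>G\<^esub> l)) = x (inv\<^bsub>G\<^esub> h \<otimes>\<^bsub>G\<^esub> l)"
        using eq k l by (metis inv_closed m_closed)
    qed
    finally show ?thesis .
  qed
  have "k \<in> core G x \<longleftrightarrow> k \<in> carrier G \<and> (\<forall>h\<in>carrier G. shift G k (shift G h x) = shift G h x)"
    using one_closed by (auto simp: core_def stabilizer_def)
  also have "\<dots> \<longleftrightarrow> k \<in> carrier G \<and>
    (\<forall>h\<in>carrier G. \<forall>l\<in>carrier G. x (inv\<^bsub>G\<^esub> h \<otimes>\<^bsub>G\<^esub> k \<otimes>\<^bsub>G\<^esub> l) = x (inv\<^bsub>G\<^esub> h \<otimes>\<^bsub>G\<^esub> l))"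
    using fix_iff by blast
  also have "\<dots> \<longleftrightarrow> k \<in> carrier G \<and>
    (\<forall>h\<in>carrier G. \<forall>l\<in>carrier G. x (h \<otimes>\<^bsub>G\<^esub> k \<otimes>\<^bsub>G\<^esub> l) = x (h \<otimes>\<^bsub>G\<^esub> l))"
    by (metis inv_closed inv_inv)
  finally show ?thesis .
qed

lemma closedin_equal_letters:
  assumes "finite A" "g \<in> carrier G" "h \<in> carrier G"
  shows "closedin (prodiscrete G A) {x \<in> configurations G A. x g = x h}"
proof -
  have cl: "closedin (prodiscrete G A) {x \<in> topspace (prodiscrete G A). x g \<in> {a}}" if "g \<in> carrier G" "a \<in> A" for g a
    unfolding prodiscrete_def
    by (rule closedin_continuous_map_preimage[OF continuous_map_product_projection[OF that(1)]])
       (use that in simp)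
  have "{x \<in> configurations G A. x g = x h} =
      (\<Union>a\<in>A. {x \<in> topspace (prodiscrete G A). x g \<in> {a}} \<inter> {x \<in> topspace (prodiscrete G A). x h \<in> {a}})"
    using assms by (auto simp: topspace_prodiscrete configurations_def)
  then show ?thesis using cl assms by (auto intro!: closedin_Union closedin_Int)
qed

text \<open>
  By compactness: the points whose core contains a given set form a closed set, so for a chain of cores
  the corresponding closed sets have a common point, whose core contains the whole chain. Zorn's
  lemma applies.
\<close>

lemma ex_maximal_core:
  assumes "group G" "finite A" and S: "closedin (prodiscrete G A) S" "S \<noteq> {}"
  shows "\<exists>x\<in>S. \<forall>x'\<in>S. core G x \<subseteq> core G x' \<longrightarrow> core G x' = core G x"
proof -
  interpret group G by fact
  define C where "C K = {x \<in> S. K \<subseteq> core G x}" for K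
  have sub: "S \<subseteq> configurations G A"
    using closedin_subset[OF S(1)] by (simp add: topspace_prodiscrete)
  have closed: "closedin (prodiscrete G A) (C K)" if "K \<subseteq> carrier G" for K
  proof -
    have "C K = S \<inter> \<Inter> (insert S ((\<lambda>(k, h, l). {x \<in> configurations G A. x (h \<otimes>\<^bsub>G\<^esub> k \<otimes>\<^bsub>G\<^esub> l) = x (h \<otimes>\<^bsub>G\<^esub> l)}) `
        (K \<times> carrier G \<times> carrier G)))"
      using that sub unfolding C_def by (auto simp: core_iff[OF assms(1)] subset_iff)
    moreover have "closedin (prodiscrete G A) \<dots>"
      using S(1) that assms(2)
      by (intro closedin_Int closedin_Inter) (auto intro!: closedin_equal_letters)
    ultimately show ?thesis by simp
  qed
  have compact: "compact_space (prodiscrete G A)"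
    unfolding prodiscrete_def by (simp add: compact_space_product_topology compact_space_discrete_topology assms(2))
  have "\<exists>M\<in>core G ` S. \<forall>X\<in>core G ` S. M \<subseteq> X \<longrightarrow> X = M"
  proof (rule subset_Zorn)
    fix \<C> assume chain: "subset.chain (core G ` S) \<C>"
    show "\<exists>U\<in>core G ` S. \<forall>X\<in>\<C>. X \<subseteq> U"
    proof (cases "\<C> = {}")
      case True
      then show ?thesis using S(2) by auto
    next
      case False
      have sub: "\<C> \<subseteq> core G ` S" and total: "\<And>X X'. X \<in> \<C> \<Longrightarrow> X' \<in> \<C> \<Longrightarrow> X \<subseteq> X' \<or> X' \<subseteq> X"
        using chain by (auto simp: subset.chain_def)
      have car: "X \<subseteq> carrier G" if "X \<in> \<C>" for X using sub that by (auto simp: core_iff[OF assms(1)])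
      have "\<Inter> (C ` \<C>) \<noteq> {}"
      proof (rule compact[unfolded compact_space_fip, rule_format], intro conjI ballI allI impI)
        fix D assume "D \<in> C ` \<C>"
        then show "closedin (prodiscrete G A) D" using closed car by auto
      next
        fix \<F> assume "finite \<F> \<and> \<F> \<subseteq> C ` \<C>"
        then obtain \<D> where D: "finite \<D>" "\<D> \<subseteq> \<C>" "\<F> = C ` \<D>" by (meson finite_subset_image)
        show "\<Inter>\<F> \<noteq> {}"
        proof (cases "\<D> = {}")
          case False
          have "\<exists>M\<in>\<D>. \<forall>X\<in>\<D>. X \<subseteq> M"
            using D(1) False D(2)
          proof (induction \<D> rule: finite_ne_induct)
            case (insert X \<D>)
            then obtain M where M: "M \<in> \<D>" "\<forall>X\<in>\<D>. X \<subseteq> M" by auto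
            then have "X \<subseteq> M \<or> M \<subseteq> X" using insert.prems by (intro total) auto
            then show ?case
            proof
              assume "X \<subseteq> M"
              then show ?thesis using M by auto
            next
              assume "M \<subseteq> X"
              then have "\<forall>X'\<in>insert X \<D>. X' \<subseteq> X" using M by blast
              then show ?thesis by blast
            qed
          qed auto
          then obtain M where M: "M \<in> \<D>" "\<forall>X\<in>\<D>. X \<subseteq> M" by blast
          obtain x where "x \<in> S" "M = core G x" using M(1) D(2) sub by blast
          then have "x \<in> \<Inter>\<F>" using M(2) by (auto simp: D(3) C_def)
          then show ?thesis by blast
        qed (simp add: D)
      qed
      then obtain x where x: "x \<in> \<Inter> (C ` \<C>)" by blast
      then have "x \<in> S" "\<forall>X\<in>\<C>. X \<subseteq> core G x" using False by (auto simp: C_def)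
      then show ?thesis by blast
    qed
  qed
  then show ?thesis by blast
qed

section \<open>Configurations as invariant colourings\<close>

text \<open>
  Generators beyond the first \<open>p\<close> are sent to the unit, so that every word has a value in \<open>G\<close>.
\<close>

definition letter_images :: "nat \<Rightarrow> ('g, 'm) monoid_scheme \<Rightarrow> (letter list \<Rightarrow> 'g) \<Rightarrow> letter \<Rightarrow> 'g" where
  "letter_images p G \<phi> a = (if fst a < p then \<phi> [a] else \<one>\<^bsub>G\<^esub>)"

text \<open>
  Lifts to words of the configurations that avoid \<open>L\<close> and whose core contains the image of \<open>Z\<close>.
\<close>

definition admissible_colouring :: "('g, 'm) monoid_scheme \<Rightarrow> nat \<Rightarrow> (letter list \<Rightarrow> 'g) \<Rightarrow>
    nat set \<Rightarrow> (letter list \<Rightarrow> nat option) set \<Rightarrow> letter list set \<Rightarrow> (letter list \<Rightarrow> nat) \<Rightarrow> bool" where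
  "admissible_colouring G p \<phi> A L Z Y \<longleftrightarrow> range Y \<subseteq> A \<and>
     invariant_under (cancelling_pairs p \<union> word_problem p G \<phi> \<union> Z) Y \<and>
     (\<forall>w\<in>L. \<exists>v a. w v = Some a \<and> Y v \<noteq> a)"

context
  fixes G :: "('g, 'm) monoid_scheme" and p :: nat and \<phi> :: "letter list \<Rightarrow> 'g"
  assumes group: "group G" and epi: "\<phi> \<in> epi (free_group p) G"
begin

interpretation group G by (rule group)

lemma phi_hom: "\<phi> \<in> hom (free_group p) G" and phi_surj: "\<phi> ` carrier (free_group p) = carrier G"
  using epi by (auto simp: epi_def)

lemma phi_closed [simp]: "u \<in> carrier (free_group p) \<Longrightarrow> \<phi> u \<in> carrier G"
  using phi_surj by blast

lemma letter_images_closed: "letter_images p G \<phi> a \<in> carrier G"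
  by (simp add: letter_images_def)

lemma letter_images_inv: "letter_images p G \<phi> (letter_inv a) = inv\<^bsub>G\<^esub> (letter_images p G \<phi> a)"
  using hom_letter_inv[OF group phi_hom] by (simp add: letter_images_def)

lemmas eval_images = eval_word_append[where m = "letter_images p G \<phi>", OF group letter_images_closed letter_images_inv]
  eval_word_closed[where m = "letter_images p G \<phi>", OF group letter_images_closed letter_images_inv]
  eval_word_inv[where m = "letter_images p G \<phi>", OF group letter_images_closed letter_images_inv]

lemma eval_letter_images: "u \<in> carrier (free_group p) \<Longrightarrow> eval_word G (letter_images p G \<phi>) u = \<phi> u"
  by (rule hom_eq_eval_word[OF group phi_hom]) (simp_all add: letter_images_def)

lemma phi_reduce:
  assumes "u \<in> carrier (free_group p)" "v \<in> carrier (free_group p)"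
  shows "\<phi> (foldr cancel_cons u v) = \<phi> u \<otimes>\<^bsub>G\<^esub> \<phi> v"
  using hom_mult[OF phi_hom assms] by simp

lemma word_problem_iff: "u \<in> word_problem p G \<phi> \<longleftrightarrow> u \<in> carrier (free_group p) \<and> \<phi> u = \<one>\<^bsub>G\<^esub>"
  by (simp add: word_problem_def kernel_def)

text \<open>
  If \<open>u\<close> and \<open>v\<close> have the same image, then the reduced form of \<open>u\<^sup>-\<^sup>1 v\<close> is in the word problem,
  so the invariant colouring cannot separate them.
\<close>

lemma configuration_of_colouring:
  assumes pairs: "invariant_under (cancelling_pairs p) Y" and W: "invariant_under (word_problem p G \<phi>) Y"
  obtains x where "x \<in> extensional (carrier G)" "\<And>u. u \<in> carrier (free_group p) \<Longrightarrow> x (\<phi> u) = Y u"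
proof -
  have eq: "Y u = Y v" if "u \<in> carrier (free_group p)" "v \<in> carrier (free_group p)" "\<phi> u = \<phi> v" for u v
  proof -
    have "interchangeable Y (foldr cancel_cons (word_inv u) v) []"
      using kernel_if_equal_images[OF group phi_hom that] W by (simp add: invariant_under_iff)
    then show ?thesis
      using interchangeableD[OF interchangeable_if_kernel[OF pairs, of u v]] that(1)
      by (simp add: carrier_free_group)
  qed
  define x where "x = (\<lambda>g\<in>carrier G. Y (SOME u. u \<in> carrier (free_group p) \<and> \<phi> u = g))"
  have "x (\<phi> u) = Y u" if "u \<in> carrier (free_group p)" for u
  proof -
    have "\<exists>v. v \<in> carrier (free_group p) \<and> \<phi> v = \<phi> u" using that by blast
    from someI_ex[OF this] show ?thesis using that by (auto simp: x_def intro: eq)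
  qed
  then show ?thesis using that[of x] by (simp add: x_def)
qed

lemma core_of_colouring:
  assumes pairs: "invariant_under (cancelling_pairs p) Y"
    and x: "\<And>u. u \<in> carrier (free_group p) \<Longrightarrow> x (\<phi> u) = Y u"
    and z: "z \<in> carrier (free_group p)" "interchangeable Y z []"
  shows "\<phi> z \<in> core G x"
proof -
  have "x (g \<otimes>\<^bsub>G\<^esub> \<phi> z \<otimes>\<^bsub>G\<^esub> g') = x (g \<otimes>\<^bsub>G\<^esub> g')" if g: "g \<in> carrier G" "g' \<in> carrier G" for g g'
  proof -
    obtain h l where h: "h \<in> carrier (free_group p)" "g = \<phi> h" and l: "l \<in> carrier (free_group p)" "g' = \<phi> l"
      using g phi_surj by blast
    have sub: "fst ` set h \<subseteq> {..<p}" "fst ` set z \<subseteq> {..<p}" using h z by (auto simp: carrier_free_group)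
    note red = reduce_carrier[OF sub(1)] reduce_carrier[OF sub(2)]
    have "interchangeable Y (foldr cancel_cons h (foldr cancel_cons z l)) (h @ foldr cancel_cons z l)"
      by (rule interchangeable_reduce[OF pairs sub(1)])
    also have "interchangeable Y \<dots> (h @ z @ l)"
      by (intro interchangeable_append interchangeable_refl interchangeable_reduce[OF pairs sub(2)])
    also have "interchangeable Y \<dots> (h @ [] @ l)"
      by (intro interchangeable_append interchangeable_refl z)
    also have "interchangeable Y \<dots> (foldr cancel_cons h l)"
      using interchangeable_reduce[OF pairs sub(1)] by (auto intro: interchangeable_sym)
    finally have "Y (foldr cancel_cons h (foldr cancel_cons z l)) = Y (foldr cancel_cons h l)"
      by (rule interchangeableD)
    moreover have "\<phi> (foldr cancel_cons h (foldr cancel_cons z l)) = g \<otimes>\<^bsub>G\<^esub> \<phi> z \<otimes>\<^bsub>G\<^esub> g'"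
      "\<phi> (foldr cancel_cons h l) = g \<otimes>\<^bsub>G\<^esub> g'"
      using h l z red by (simp_all add: phi_reduce m_assoc)
    ultimately show ?thesis using x red(1) red(2)[OF l(1)] l(1) by metis
  qed
  then show ?thesis using z by (simp add: core_iff[OF group])
qed

lemma interchangeable_of_configuration:
  assumes "eval_word G (letter_images p G \<phi>) z \<in> core G x"
  shows "interchangeable (\<lambda>u. x (eval_word G (letter_images p G \<phi>) u)) z []"
  using assms by (simp add: interchangeable_def core_iff[OF group] eval_images m_assoc)

lemma one_core: "\<one>\<^bsub>G\<^esub> \<in> core G x"
  by (simp add: core_iff[OF group])

lemma eval_cancelling_pair: "z \<in> cancelling_pairs p \<Longrightarrow> eval_word G (letter_images p G \<phi>) z = \<one>\<^bsub>G\<^esub>"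
  by (auto simp: cancelling_pairs_def letter_images_inv letter_images_closed)

lemma admissible_colouring_iff:
  assumes L: "L \<subseteq> words p A" and Z: "Z \<subseteq> carrier (free_group p)"
  shows "(\<exists>Y. admissible_colouring G p \<phi> A L Z Y) \<longleftrightarrow> (\<exists>x\<in>avoiding G \<phi> A L. \<phi> ` Z \<subseteq> core G x)"
proof
  assume "\<exists>Y. admissible_colouring G p \<phi> A L Z Y"
  then obtain Y where Y: "range Y \<subseteq> A" "invariant_under (cancelling_pairs p) Y"
      "invariant_under (word_problem p G \<phi>) Y" "invariant_under Z Y"
      "\<And>w. w \<in> L \<Longrightarrow> \<exists>v a. w v = Some a \<and> Y v \<noteq> a"
    unfolding admissible_colouring_def invariant_under_iff by blast
  obtain x where x: "x \<in> extensional (carrier G)" "\<And>u. u \<in> carrier (free_group p) \<Longrightarrow> x (\<phi> u) = Y u"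
    using configuration_of_colouring[OF Y(2,3)] by blast
  have "x g \<in> A" if g: "g \<in> carrier G" for g
  proof -
    obtain u where "u \<in> carrier (free_group p)" "g = \<phi> u" using phi_surj g by blast
    then show ?thesis using x(2) Y(1) by auto
  qed
  then have "x \<in> configurations G A" using x(1) by (auto simp: configurations_def PiE_def)
  moreover have "disagrees \<phi> x w" if w: "w \<in> L" for w
  proof -
    obtain v a where v: "w v = Some a" "Y v \<noteq> a" using Y(5)[OF w] by blast
    then have "v \<in> carrier (free_group p)" using L w by (auto simp: words_def)
    then show ?thesis using x(2)[of v] v unfolding disagrees_def by metis
  qed
  moreover have "\<phi> ` Z \<subseteq> core G x"
    using Y(4) Z by (auto simp: invariant_under_iff intro!: core_of_colouring[OF Y(2) x(2)])
  ultimately show "\<exists>x\<in>avoiding G \<phi> A L. \<phi> ` Z \<subseteq> core G x" by (auto simp: avoiding_def)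
next
  assume "\<exists>x\<in>avoiding G \<phi> A L. \<phi> ` Z \<subseteq> core G x"
  then obtain x where x: "x \<in> avoiding G \<phi> A L" "\<phi> ` Z \<subseteq> core G x" by blast
  define Y where "Y u = x (eval_word G (letter_images p G \<phi>) u)" for u
  have "eval_word G (letter_images p G \<phi>) z \<in> core G x"
    if "z \<in> cancelling_pairs p \<union> word_problem p G \<phi> \<union> Z" for z
    using that x(2) Z one_core
    by (auto simp: eval_cancelling_pair eval_letter_images word_problem_iff subset_iff image_subset_iff)
  then have "invariant_under (cancelling_pairs p \<union> word_problem p G \<phi> \<union> Z) Y"
    unfolding invariant_under_iff Y_def by (blast intro: interchangeable_of_configuration)
  moreover have "range Y \<subseteq> A"
    using x(1) eval_images(2) unfolding Y_def avoiding_def configurations_def by blast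
  moreover have "\<exists>v a. w v = Some a \<and> Y v \<noteq> a" if w: "w \<in> L" for w
  proof -
    obtain v a where v: "w v = Some a" "x (\<phi> v) \<noteq> a"
      using x(1) w by (auto simp: avoiding_def disagrees_def)
    then have "v \<in> carrier (free_group p)" using L w by (auto simp: words_def)
    then show ?thesis using v by (metis Y_def eval_letter_images)
  qed
  ultimately show "\<exists>Y. admissible_colouring G p \<phi> A L Z Y" unfolding admissible_colouring_def by blast
qed

end

section \<open>Certificates\<close>

text \<open>
  A form of enumeration reducibility with a total test: membership of \<open>n\<close> is witnessed by a number \<open>i\<close>
  and a finite subset of the oracle, given by its canonical index \<open>s\<close>. For the empty oracle this
  says that \<open>B\<close> is recursively enumerable.
\<close>

definition certifies :: "(nat \<Rightarrow> nat \<Rightarrow> nat \<Rightarrow> bool) \<Rightarrow> nat set \<Rightarrow> nat set \<Rightarrow> bool" where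
  "certifies T B C \<longleftrightarrow> recursive_pred (\<lambda>t. T (pfst t) (pfst (psnd t)) (psnd (psnd t))) \<and>
     (\<forall>n. n \<in> B \<longleftrightarrow> (\<exists>i s. set_decode s \<subseteq> C \<and> T n i s))"

lemma certifies_reducible:
  assumes "certifies T B C" shows "B \<le>\<^sub>e C"
proof -
  have "partial_recursive (\<lambda>t. if T (pfst t) (pfst (psnd t)) (psnd (psnd t)) then Some (psnd (psnd t)) else None)"
    using assms unfolding certifies_def by (intro partial_recursive_if recursive_intros) auto
  moreover have "n \<in> B \<longleftrightarrow> (\<exists>i d. (\<lambda>t. if T (pfst t) (pfst (psnd t)) (psnd (psnd t))
      then Some (psnd (psnd t)) else None) (prod_encode (n, i)) = Some d \<and> set_decode d \<subseteq> C)" for n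
  proof -
    have "(\<exists>i s. set_decode s \<subseteq> C \<and> T n i s) \<longleftrightarrow> (\<exists>i. set_decode (psnd i) \<subseteq> C \<and> T n (pfst i) (psnd i))"
      by (metis fst_conv snd_conv prod_encode_inverse)
    then show ?thesis using assms by (auto simp: certifies_def split: if_splits)
  qed
  ultimately show ?thesis unfolding enumeration_reducible_def by blast
qed

lemma set_decode_less: "e \<in> set_decode w \<Longrightarrow> e < w"
proof (rule ccontr)
  assume "e \<in> set_decode w" "\<not> e < w"
  moreover have "e < 2 ^ e" by (rule less_exp)
  ultimately have "w < 2 ^ e" by linarith
  then show False using \<open>e \<in> set_decode w\<close> by (simp add: set_decode_def)
qed

text \<open>
  Occurrence of a forbidden pattern. Bounding its domain by \<open>i\<close> makes this depend on the values of
  \<open>y\<close> below \<open>i\<close> alone, at the price of holding only from some \<open>i\<close> on.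
\<close>

definition matches :: "nat \<Rightarrow> (nat \<Rightarrow> nat) \<Rightarrow> nat \<Rightarrow> bool" where
  "matches i y w \<longleftrightarrow> (\<forall>e<w. e \<in> set_decode w \<longrightarrow> pfst e < i \<and> y (pfst e) = psnd e)"

lemma matches_local: "(\<And>k. k < i \<Longrightarrow> y k = y' k) \<Longrightarrow> matches i y w \<Longrightarrow> matches i y' w"
  unfolding matches_def by metis

lemma matches_mono: "i \<le> j \<Longrightarrow> matches i y w \<Longrightarrow> matches j y w"
  unfolding matches_def by (meson less_le_trans)

lemma matches_iff: "(\<exists>i. matches i y w) \<longleftrightarrow> (\<forall>e\<in>set_decode w. y (pfst e) = psnd e)"
proof
  assume "\<forall>e\<in>set_decode w. y (pfst e) = psnd e"
  moreover have "pfst e < Suc w" if "e < w" for e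
    using that le_prod_encode_1[of "pfst e" "psnd e"] by simp
  ultimately have "matches (Suc w) y w" by (simp add: matches_def)
  then show "\<exists>i. matches i y w" ..
qed (auto simp: matches_def dest: set_decode_less)

lemma set_decode_word_code:
  assumes "finite (dom w)"
  shows "set_decode (word_code w) = {prod_encode (code u, a) | u a. w u = Some a}"
proof -
  have "{prod_encode (code u, a) | u a. w u = Some a} = (\<lambda>u. prod_encode (code u, the (w u))) ` dom w"
    by force
  then have "finite {prod_encode (code u, a) | u a. w u = Some a}" using assms by simp
  then show ?thesis by (simp add: word_code_def)
qed

lemma matches_word_code:
  assumes "finite (dom w)"
  shows "(\<exists>i. matches i y (word_code w)) \<longleftrightarrow> (\<forall>u a. w u = Some a \<longrightarrow> y (code u) = a)"
  unfolding matches_iff set_decode_word_code[OF assms] by fastforce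

lemma pred_matches:
  assumes y: "total_recursive (\<lambda>t. y (pfst t) (psnd t))" and I: "total_recursive I" and W: "total_recursive W"
  shows "recursive_pred (\<lambda>n. matches (I n) (y n) (W n))"
  unfolding matches_def
  by (intro recursive_intros I W rec_compose[OF I] rec_compose[OF W] rec_compose2[OF y])

lemma rec_digit [recursive_intros]:
  assumes "total_recursive F" "total_recursive K"
  shows "total_recursive (\<lambda>n. digit B (F n) (K n))"
  unfolding digit_def by (intro recursive_intros assms)

lemma recursively_enumerable_projection:
  assumes "recursively_enumerable X"
  shows "\<exists>R. recursive_pred (\<lambda>t. R (pfst t) (psnd t)) \<and> (\<forall>w. w \<in> X \<longleftrightarrow> (\<exists>j. R j w))"
proof (cases "X = {}")
  case True
  then show ?thesis by (intro exI[of _ "\<lambda>j w. False"]) (simp add: pred_const)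
next
  case False
  then obtain f where f: "total_recursive f" "X = range f"
    using assms by (auto simp: recursively_enumerable_def)
  have "recursive_pred (\<lambda>t. psnd t = f (pfst t))" by (intro recursive_intros rec_compose[OF f(1)])
  then show ?thesis by (intro exI[of _ "\<lambda>j w. w = f j"]) (auto simp: f(2))
qed

text \<open>
  A stage-\<open>i\<close> refutation uses only oracle elements below \<open>i\<close>. By compactness, refuting all
  colourings takes one stage, hence a finite part of the oracle.
\<close>

lemma oracle_certificate:
  fixes P :: "nat set \<Rightarrow> nat \<Rightarrow> (nat \<Rightarrow> nat) \<Rightarrow> bool"
  assumes loc: "\<And>D i y y'. (\<And>k. k < i \<Longrightarrow> y k = y' k) \<Longrightarrow> P D i y \<Longrightarrow> P D i y'"
    and mono: "\<And>D D' i j y. i \<le> j \<Longrightarrow> D \<inter> {..<i} \<subseteq> D' \<Longrightarrow> P D i y \<Longrightarrow> P D' j y"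
    and B: "B > 0"
  shows "(\<exists>i s. set_decode s \<subseteq> C \<and> (\<forall>\<sigma><B ^ i. P (set_decode s) i (digit B \<sigma>))) \<longleftrightarrow>
    (\<forall>y. (\<forall>k. y k < B) \<longrightarrow> (\<exists>i. P C i y))"
proof -
  have "(\<forall>y. (\<forall>k. y k < B) \<longrightarrow> (\<exists>i. P C i y)) \<longleftrightarrow> (\<exists>i. \<forall>\<sigma><B ^ i. P C i (digit B \<sigma>))"
    by (rule colouring_certificate) (fact loc, rule mono, auto simp: B)
  also have "\<dots> \<longleftrightarrow> (\<exists>i s. set_decode s \<subseteq> C \<and> (\<forall>\<sigma><B ^ i. P (set_decode s) i (digit B \<sigma>)))"
  proof
    assume "\<exists>i. \<forall>\<sigma><B ^ i. P C i (digit B \<sigma>)"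
    then obtain i where i: "\<And>\<sigma>. \<sigma> < B ^ i \<Longrightarrow> P C i (digit B \<sigma>)" by blast
    define s where "s = set_encode (C \<inter> {..<i})"
    have s: "set_decode s = C \<inter> {..<i}" by (simp add: s_def)
    have "P (set_decode s) i (digit B \<sigma>)" if "\<sigma> < B ^ i" for \<sigma>
      by (rule mono[OF order_refl _ i[OF that]]) (simp add: s)
    then show "\<exists>i s. set_decode s \<subseteq> C \<and> (\<forall>\<sigma><B ^ i. P (set_decode s) i (digit B \<sigma>))"
      using s by blast
  next
    assume "\<exists>i s. set_decode s \<subseteq> C \<and> (\<forall>\<sigma><B ^ i. P (set_decode s) i (digit B \<sigma>))"
    then obtain i s where s: "set_decode s \<subseteq> C" "\<And>\<sigma>. \<sigma> < B ^ i \<Longrightarrow> P (set_decode s) i (digit B \<sigma>)" by blast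
    have "P C i (digit B \<sigma>)" if "\<sigma> < B ^ i" for \<sigma>
      by (rule mono[OF order_refl _ s(2)[OF that]]) (use s(1) in blast)
    then show "\<exists>i. \<forall>\<sigma><B ^ i. P C i (digit B \<sigma>)" by blast
  qed
  finally show ?thesis by blast
qed

section \<open>Words outside a maximal core\<close>

text \<open>
  Stage \<open>i\<close> of a refutation of \<open>y\<close>: a value outside the alphabet, a clash with one of the relators, or
  an occurrence of a forbidden pattern enumerated by \<open>R\<close>. The input \<open>n\<close> itself is one of the relators.
\<close>

definition bad_colouring :: "nat set \<Rightarrow> nat set \<Rightarrow> (nat \<Rightarrow> nat \<Rightarrow> bool) \<Rightarrow> nat \<Rightarrow> nat set \<Rightarrow> nat \<Rightarrow> (nat \<Rightarrow> nat) \<Rightarrow> bool" where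
  "bad_colouring A Z R n D i y \<longleftrightarrow> (\<exists>c<i. y c \<notin> A) \<or> clash (Z \<union> {n} \<union> D) i y \<or>
     (\<exists>j<i. \<exists>w<i. R j w \<and> matches i y w)"

lemma bad_colouring_local:
  assumes "\<And>k. k < i \<Longrightarrow> y k = y' k" "bad_colouring A Z R n D i y"
  shows "bad_colouring A Z R n D i y'"
proof -
  have "clash E i y \<Longrightarrow> clash E i y'" "matches i y w \<Longrightarrow> matches i y' w" for E w
    by (erule clash_local[rotated] matches_local[rotated], simp add: assms(1))+
  then show ?thesis using assms unfolding bad_colouring_def by (elim disjE) (force, blast, blast)
qed

lemma bad_colouring_mono:
  assumes "i \<le> j" "D \<inter> {..<i} \<subseteq> D'" "bad_colouring A Z R n D i y"
  shows "bad_colouring A Z R n D' j y"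
proof -
  have "(Z \<union> {n} \<union> D) \<inter> {..<i} \<subseteq> Z \<union> {n} \<union> D'" using assms(2) by blast
  then have "clash (Z \<union> {n} \<union> D) i y \<Longrightarrow> clash (Z \<union> {n} \<union> D') j y" by (rule clash_mono[OF assms(1)])
  moreover have "matches i y w \<Longrightarrow> matches j y w" for w by (rule matches_mono[OF assms(1)])
  ultimately show ?thesis
    using assms(1,3) unfolding bad_colouring_def by (meson less_le_trans)
qed

lemma pred_bad_colouring:
  assumes "finite A" "finite Z" "recursive_pred (\<lambda>t. R (pfst t) (psnd t))"
    and "total_recursive N" "total_recursive D" "total_recursive I" "total_recursive \<Sigma>"
  shows "recursive_pred (\<lambda>t. bad_colouring A Z R (N t) (set_decode (D t)) (I t) (digit B (\<Sigma> t)))"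
  unfolding bad_colouring_def
  by (intro recursive_intros pred_in_finite[OF assms(1)] pred_clash pred_matches pred_compose2[OF assms(3)]
        assms(6) rec_compose[OF assms(6)] rec_compose[OF assms(7)])
     (simp only: Un_iff insert_iff empty_iff simp_thms,
      intro recursive_intros pred_in_finite[OF assms(2)] rec_compose[OF assms(4)] rec_compose[OF assms(5)])

lemma ex_bad_colouring_iff:
  assumes L: "L \<subseteq> words p A" and R: "\<And>w. w \<in> word_code ` L \<longleftrightarrow> (\<exists>j. R j w)"
  shows "(\<exists>i. bad_colouring A (code ` Z) R (code u) (code ` W) i y) \<longleftrightarrow>
    \<not> (range y \<subseteq> A \<and> invariant_under (Z \<union> {u} \<union> W) (\<lambda>v. y (code v)) \<and>
       (\<forall>w\<in>L. \<exists>v a. w v = Some a \<and> y (code v) \<noteq> a))"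
proof -
  have e1: "(\<exists>i. bad_colouring A (code ` Z) R (code u) (code ` W) i y) \<longleftrightarrow>
     (\<exists>i. \<exists>c<i. y c \<notin> A) \<or> (\<exists>i. clash (code ` Z \<union> {code u} \<union> code ` W) i y) \<or>
     (\<exists>i. \<exists>j<i. \<exists>w<i. R j w \<and> matches i y w)"
    unfolding bad_colouring_def by blast
  have e2: "(\<exists>i. \<exists>c<i. y c \<notin> A) \<longleftrightarrow> \<not> range y \<subseteq> A" by (auto intro: lessI)
  have e3: "(\<exists>i. clash (code ` Z \<union> {code u} \<union> code ` W) i y) \<longleftrightarrow>
      \<not> invariant_under (Z \<union> {u} \<union> W) (\<lambda>v. y (code v))"
    unfolding clash_iff by (simp add: image_Un image_image)
  have e4: "(\<exists>i. \<exists>j<i. \<exists>w<i. R j w \<and> matches i y w) \<longleftrightarrow>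
      (\<exists>w\<in>L. \<forall>v a. w v = Some a \<longrightarrow> y (code v) = a)"
  proof -
    have "(\<exists>i. \<exists>j<i. \<exists>w<i. R j w \<and> matches i y w) \<longleftrightarrow> (\<exists>j w i. R j w \<and> matches i y w)"
    proof
      assume "\<exists>j w i. R j w \<and> matches i y w"
      then obtain j w i where "R j w" "matches i y w" by blast
      moreover from this(2) have "matches (Suc (i + j + w)) y w" by (rule matches_mono[rotated]) simp
      ultimately show "\<exists>i. \<exists>j<i. \<exists>w<i. R j w \<and> matches i y w"
        using less_Suc_eq_le[of j "i + j + w"] less_Suc_eq_le[of w "i + j + w"]
        by (meson le_add1 le_add2 trans_le_add1)
    qed blast
    also have "\<dots> \<longleftrightarrow> (\<exists>w\<in>word_code ` L. \<exists>i. matches i y w)" using R by blast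
    also have "\<dots> \<longleftrightarrow> (\<exists>w\<in>L. \<exists>i. matches i y (word_code w))" by blast
    also have "\<dots> \<longleftrightarrow> (\<exists>w\<in>L. \<forall>v a. w v = Some a \<longrightarrow> y (code v) = a)"
      using L by (intro bex_cong refl matches_word_code) (auto simp: words_def)
    finally show ?thesis .
  qed
  show ?thesis unfolding e1 e2 e3 e4 de_Morgan_conj by simp
qed

text \<open>
  Let \<open>K\<close> be a finite set of words that represent the core of \<open>x\<close>. A configuration of the subshift
  whose core contains the images of \<open>K\<close> and \<open>u\<close> exists exactly if \<open>\<phi> u\<close> is in the core of \<open>x\<close>: if it is, \<open>x\<close> is one, and
  otherwise its core would be strictly larger than a maximal one. The non-existence is a statement
  about colourings, which is certified by a finite refutation.
\<close>

lemma certifies_outside_core: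
  assumes group: "group G" and epi: "\<phi> \<in> epi (free_group p) G" and A: "finite A"
    and L: "L \<subseteq> words p A" "recursively_enumerable (word_code ` L)"
    and x: "x \<in> avoiding G \<phi> A L" "finite (core G x)"
    and max: "\<And>x'. x' \<in> avoiding G \<phi> A L \<Longrightarrow> core G x \<subseteq> core G x' \<Longrightarrow> core G x' = core G x"
  shows "\<exists>T. certifies T (code ` {u \<in> carrier (free_group p). \<phi> u \<notin> core G x}) (code ` word_problem p G \<phi>)"
proof -
  obtain R where R: "recursive_pred (\<lambda>t. R (pfst t) (psnd t))" "\<And>w. w \<in> word_code ` L \<longleftrightarrow> (\<exists>j. R j w)"
    using recursively_enumerable_projection[OF L(2)] by auto
  have "core G x \<subseteq> \<phi> ` carrier (free_group p)"
    using epi by (auto simp: epi_def core_iff[OF group])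
  then obtain K where K: "K \<subseteq> carrier (free_group p)" "finite K" "\<phi> ` K = core G x"
    using finite_subset_image[OF x(2)] by metis
  define B where "B = Suc (\<Sum>A)"
  have AB: "a < B" if "a \<in> A" for a
    using member_le_sum[of a A "\<lambda>a. a"] A that by (simp add: B_def less_Suc_eq_le)
  define Z where "Z = cancelling_pairs p \<union> K"
  have fin: "finite (code ` Z)" using K(2) by (simp add: Z_def finite_cancelling_pairs)
  define T where "T n i s \<longleftrightarrow> n \<in> code ` carrier (free_group p) \<and>
    (\<forall>\<sigma><B ^ i. bad_colouring A (code ` Z) R n (set_decode s) i (digit B \<sigma>))" for n i s
  have "recursive_pred (\<lambda>t. T (pfst t) (pfst (psnd t)) (psnd (psnd t)))"
    unfolding T_def
    by (intro recursive_intros pred_compose[OF pred_carrier] pred_bad_colouring A fin R(1))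
  moreover have "n \<in> code ` {u \<in> carrier (free_group p). \<phi> u \<notin> core G x} \<longleftrightarrow>
      (\<exists>i s. set_decode s \<subseteq> code ` word_problem p G \<phi> \<and> T n i s)" for n
  proof (cases "n \<in> code ` carrier (free_group p)")
    case True
    then obtain u where u: "n = code u" "u \<in> carrier (free_group p)" by blast
    have "(\<exists>i s. set_decode s \<subseteq> code ` word_problem p G \<phi> \<and> T n i s) \<longleftrightarrow>
      (\<exists>i s. set_decode s \<subseteq> code ` word_problem p G \<phi> \<and>
        (\<forall>\<sigma><B ^ i. bad_colouring A (code ` Z) R n (set_decode s) i (digit B \<sigma>)))"
      using True by (simp add: T_def)
    also have "\<dots> \<longleftrightarrow>
      (\<forall>y. (\<forall>k. y k < B) \<longrightarrow> (\<exists>i. bad_colouring A (code ` Z) R n (code ` word_problem p G \<phi>) i y))"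
      by (rule oracle_certificate)
        (erule bad_colouring_local[rotated], simp, erule bad_colouring_mono, assumption+, simp add: B_def)
    also have "\<dots> \<longleftrightarrow> \<not> (\<exists>Y. admissible_colouring G p \<phi> A L (K \<union> {u}) Y)"
    proof -
      have "(\<exists>Y. admissible_colouring G p \<phi> A L (K \<union> {u}) Y) \<longleftrightarrow>
          (\<exists>y. (\<forall>k. y k < B) \<and> \<not> (\<exists>i. bad_colouring A (code ` Z) R n (code ` word_problem p G \<phi>) i y))"
      proof -
        have un: "Z \<union> {u} \<union> word_problem p G \<phi> = cancelling_pairs p \<union> word_problem p G \<phi> \<union> (K \<union> {u})"
          by (auto simp: Z_def)
        show ?thesis
          unfolding u(1) ex_bad_colouring_iff[OF L(1) R(2)] un not_not
        proof
          assume "\<exists>Y. admissible_colouring G p \<phi> A L (K \<union> {u}) Y"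
          then obtain Y where Y: "admissible_colouring G p \<phi> A L (K \<union> {u}) Y" ..
          have "range (Y \<circ> decode) \<subseteq> A" using Y by (auto simp: admissible_colouring_def)
          then show "\<exists>y. (\<forall>k. y k < B) \<and> range y \<subseteq> A \<and>
            invariant_under (cancelling_pairs p \<union> word_problem p G \<phi> \<union> (K \<union> {u})) (\<lambda>v. y (code v)) \<and>
            (\<forall>w\<in>L. \<exists>v a. w v = Some a \<and> y (code v) \<noteq> a)"
            using Y AB by (intro exI[of _ "Y \<circ> decode"]) (auto simp: admissible_colouring_def)
        next
          assume "\<exists>y. (\<forall>k. y k < B) \<and> range y \<subseteq> A \<and>
            invariant_under (cancelling_pairs p \<union> word_problem p G \<phi> \<union> (K \<union> {u})) (\<lambda>v. y (code v)) \<and>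
            (\<forall>w\<in>L. \<exists>v a. w v = Some a \<and> y (code v) \<noteq> a)"
          then obtain y where "range y \<subseteq> A"
            "invariant_under (cancelling_pairs p \<union> word_problem p G \<phi> \<union> (K \<union> {u})) (\<lambda>v. y (code v))"
            "\<forall>w\<in>L. \<exists>v a. w v = Some a \<and> y (code v) \<noteq> a" by blast
          then have "admissible_colouring G p \<phi> A L (K \<union> {u}) (\<lambda>v. y (code v))"
            unfolding admissible_colouring_def by blast
          then show "\<exists>Y. admissible_colouring G p \<phi> A L (K \<union> {u}) Y" by (rule exI[of _ "\<lambda>v. y (code v)"])
        qed
      qed
      then show ?thesis by blast
    qed
    also have "\<dots> \<longleftrightarrow> \<not> (\<exists>x'\<in>avoiding G \<phi> A L. \<phi> ` (K \<union> {u}) \<subseteq> core G x')"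
      using admissible_colouring_iff[OF group epi L(1), of "K \<union> {u}"] K(1) u(2) by simp
    also have "\<dots> \<longleftrightarrow> \<phi> u \<notin> core G x"
    proof -
      have "\<phi> ` (K \<union> {u}) \<subseteq> core G x' \<longleftrightarrow> core G x \<subseteq> core G x' \<and> \<phi> u \<in> core G x'" for x'
        using K(3) by auto
      then show ?thesis using x(1) max by blast
    qed
    finally show ?thesis using u by (auto simp: image_iff)
  qed (auto simp: T_def)
  ultimately show ?thesis unfolding certifies_def by blast
qed

section \<open>Nontrivial elements of the core\<close>

text \<open>
  Cancelling the longest common suffix reduces the product of \<open>u\<close> with the inverse of \<open>v\<close> completely.
\<close>

lemma reduced_quotient:
  assumes "reduced u" "reduced v"
  obtains u' v' s where "u = u' @ s" "v = v' @ s" "reduced (u' @ word_inv v')"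
proof -
  obtain s u' v' where s: "u = u' @ s" "v = v' @ s" "u' = [] \<or> v' = [] \<or> last u' \<noteq> last v'"
    using longest_common_suffix[of u v] by blast
  have red: "reduced u'" "reduced (word_inv v')"
    using assms s reduced_inverse[of v'] by (auto simp: reduced_def successively_append_iff word_inv_def)
  have "hd (word_inv v') = letter_inv (last v')" if "v' \<noteq> []"
    using that by (simp add: word_inv_def hd_rev last_map)
  moreover have "letter_inv a = letter_inv b \<Longrightarrow> a = b" for a b by (metis letter_inv_inv)
  ultimately have "reduced (u' @ word_inv v')"
    using red s(3) unfolding reduced_def successively_append_iff
    by (metis (no_types, lifting) list.map_disc_iff rev_is_Nil_conv word_inv_def)
  then show ?thesis using that s by blast
qed

text \<open>
  Being equal to one of the finitely many nontrivial elements of \<open>K\<close> is witnessed by a single element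
  of the word problem, the reduced form of \<open>u k\<^sup>-\<^sup>1\<close>. For a fixed \<open>k\<close> there are only finitely many suffixes that can
  cancel, so the test needs concatenation but no reduction.
\<close>

lemma certifies_nontrivial:
  assumes group: "group G" and epi: "\<phi> \<in> epi (free_group p) G" and K: "finite K" "\<one>\<^bsub>G\<^esub> \<in> K"
    and T: "certifies T (code ` {u \<in> carrier (free_group p). \<phi> u \<notin> K}) (code ` word_problem p G \<phi>)"
  shows "\<exists>T. certifies T (code ` (carrier (free_group p) - word_problem p G \<phi>)) (code ` word_problem p G \<phi>)"
proof -
  interpret group G by fact
  note images = eval_images[OF group epi] eval_letter_images[OF group epi]
  have "(K \<inter> carrier G) - {\<one>\<^bsub>G\<^esub>} \<subseteq> \<phi> ` carrier (free_group p)"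
    using epi by (auto simp: epi_def)
  then obtain K' where K': "K' \<subseteq> carrier (free_group p)" "finite K'" "\<phi> ` K' = K \<inter> carrier G - {\<one>\<^bsub>G\<^esub>}"
    using finite_subset_image[of "K \<inter> carrier G - {\<one>\<^bsub>G\<^esub>}"] K(1) by (metis finite_Diff finite_Int)
  \<comment> \<open>All ways to split a representative as \<open>k' s\<close>, stored as the pair of \<open>s\<close> and \<open>k'\<^sup>-\<^sup>1\<close>.\<close>
  define Q where "Q = (\<Union>k\<in>K'. (\<lambda>i. (code (drop i k), code (word_inv (take i k)))) ` {..length k})"
  have Q: "finite Q" using K'(2) by (simp add: Q_def)
  define T' where "T' n i s \<longleftrightarrow> n \<in> code ` carrier (free_group p) \<and> (T n i s \<or>
     (\<exists>q\<in>Q. \<exists>g<i. code_append g (fst q) = n \<and> code_append g (snd q) \<in> set_decode s))" for n i s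
  have "recursive_pred (\<lambda>t. T (pfst t) (pfst (psnd t)) (psnd (psnd t)))"
    using T by (simp add: certifies_def)
  then have "recursive_pred (\<lambda>t. T' (pfst t) (pfst (psnd t)) (psnd (psnd t)))"
    unfolding T'_def by (intro recursive_intros pred_compose[OF pred_carrier] pred_bex_finite Q)
  moreover have "n \<in> code ` (carrier (free_group p) - word_problem p G \<phi>) \<longleftrightarrow>
      (\<exists>i s. set_decode s \<subseteq> code ` word_problem p G \<phi> \<and> T' n i s)" for n
  proof (cases "n \<in> code ` carrier (free_group p)")
    case True
    then obtain u where u: "n = code u" "u \<in> carrier (free_group p)" by blast
    have T: "\<phi> u \<notin> K \<longleftrightarrow> (\<exists>i s. set_decode s \<subseteq> code ` word_problem p G \<phi> \<and> T n i s)"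
    proof -
      have "\<phi> u \<notin> K \<longleftrightarrow> n \<in> code ` {u \<in> carrier (free_group p). \<phi> u \<notin> K}" using u by auto
      also have "\<dots> \<longleftrightarrow> (\<exists>i s. set_decode s \<subseteq> code ` word_problem p G \<phi> \<and> T n i s)"
        by (rule T[unfolded certifies_def, THEN conjunct2, rule_format])
      finally show ?thesis .
    qed
    show ?thesis
    proof
      assume "n \<in> code ` (carrier (free_group p) - word_problem p G \<phi>)"
      then have "u \<notin> word_problem p G \<phi>" using u(1) by auto
      then have u1: "\<phi> u \<noteq> \<one>\<^bsub>G\<^esub>" using u(2) by (simp add: word_problem_iff[OF group epi])
      show "\<exists>i s. set_decode s \<subseteq> code ` word_problem p G \<phi> \<and> T' n i s"
      proof (cases "\<phi> u \<in> K")
        case False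
        then obtain i s where "set_decode s \<subseteq> code ` word_problem p G \<phi>" "T n i s" using T by blast
        then show ?thesis using True unfolding T'_def by blast
      next
        case True
        then have "\<phi> u \<in> \<phi> ` K'" using K'(3) u1 u(2) phi_closed[OF group epi] by auto
        then obtain k where k: "k \<in> K'" "\<phi> u = \<phi> k" by blast
        have kc: "k \<in> carrier (free_group p)" using k K' by blast
        have "reduced u" "reduced k" using u(2) kc by (simp_all add: carrier_free_group)
        then obtain u' k' t where t: "u = u' @ t" "k = k' @ t" "reduced (u' @ word_inv k')"
          by (rule reduced_quotient)
        have c: "u' @ word_inv k' \<in> carrier (free_group p)"
          using t u(2) kc by (simp add: carrier_free_group image_Un)
        let ?e = "eval_word G (letter_images p G \<phi>)"
        have "?e u' \<otimes>\<^bsub>G\<^esub> ?e t = ?e k' \<otimes>\<^bsub>G\<^esub> ?e t"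
          using k(2) images(4)[OF u(2)] images(4)[OF kc] by (simp add: t images)
        then have "?e u' = ?e k'" by (simp add: images)
        then have "\<phi> (u' @ word_inv k') = \<one>\<^bsub>G\<^esub>"
          using images(4)[OF c] by (simp add: images)
        then have W: "u' @ word_inv k' \<in> word_problem p G \<phi>"
          using c word_problem_iff[OF group epi] by blast
        have "(code t, code (word_inv k')) \<in> Q"
          using k(1) t(2) unfolding Q_def by (intro UN_I[of k] image_eqI[of _ _ "length k'"]) auto
        moreover define s where "s = set_encode {code (u' @ word_inv k')}"
        have s: "set_decode s = {code (u' @ word_inv k')}" unfolding s_def by (rule set_encode_inverse) simp
        ultimately have "T' n (Suc (code u')) s"
          using \<open>n \<in> code ` carrier (free_group p)\<close> u(1) t(1) unfolding T'_def
          by (intro conjI disjI2 bexI[of _ "(code t, code (word_inv k'))"] exI[of _ "code u'"]) simp_all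
        then show ?thesis using W s by blast
      qed
    next
      assume "\<exists>i s. set_decode s \<subseteq> code ` word_problem p G \<phi> \<and> T' n i s"
      then obtain i s where s: "set_decode s \<subseteq> code ` word_problem p G \<phi>" "T' n i s" by blast
      have "\<phi> u \<noteq> \<one>\<^bsub>G\<^esub>"
      proof (cases "T n i s")
        case True
        then have "\<phi> u \<notin> K" using T s(1) by blast
        then show ?thesis using K(2) by auto
      next
        case False
        then obtain k j g where k: "k \<in> K'" "code_append g (code (drop j k)) = n"
            "code_append g (code (word_inv (take j k))) \<in> set_decode s"
          using s(2) by (auto simp: T'_def Q_def)
        let ?e = "eval_word G (letter_images p G \<phi>)"
        have kc: "k \<in> carrier (free_group p)" using k K' by blast
        have "code (decode g @ drop j k) = code u" using k(2) u(1) by (metis code_append_code code_decode)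
        then have ug: "u = decode g @ drop j k" by simp
        have "code (decode g @ word_inv (take j k)) \<in> code ` word_problem p G \<phi>"
          using k(3) s(1) by (metis code_append_code code_decode subsetD)
        then have W: "decode g @ word_inv (take j k) \<in> word_problem p G \<phi>" by (auto simp: image_iff)
        then have "?e (decode g @ word_inv (take j k)) = \<one>\<^bsub>G\<^esub>"
          using word_problem_iff[OF group epi] images(4) by metis
        then have "?e (decode g) = ?e (take j k)"
          using images by (metis inv_equality inv_inv inv_closed)
        then have "?e u = ?e (take j k @ drop j k)" by (simp add: ug images del: append_take_drop_id)
        then have "\<phi> u = \<phi> k" using images(4)[OF u(2)] images(4)[OF kc] by simp
        then show ?thesis using k(1) K'(3) by auto
      qed
      then have "u \<in> carrier (free_group p) - word_problem p G \<phi>"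
        using u(2) by (simp add: word_problem_iff[OF group epi])
      then show "n \<in> code ` (carrier (free_group p) - word_problem p G \<phi>)"
        using u(1) by blast
    qed
  qed (auto simp: T'_def)
  ultimately show ?thesis unfolding certifies_def by blast
qed

section \<open>Finitely presented groups\<close>

text \<open>
  Renames the generators of a second free group so that they are disjoint from the first \<open>p\<close> ones.
\<close>

definition letter_shift :: "nat \<Rightarrow> letter \<Rightarrow> letter" where
  "letter_shift p a = (fst a + p, snd a)"

lemma fst_letter_shift [simp]: "fst (letter_shift p a) = fst a + p"
  and letter_shift_inv: "letter_shift p (letter_inv a) = letter_inv (letter_shift p a)"
  and letter_shift_eq [simp]: "letter_shift p a = letter_shift p b \<longleftrightarrow> a = b"
  by (auto simp: letter_shift_def letter_inv_def prod_eq_iff)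

lemma map_letter_shift_reduce:
  "map (letter_shift p) (foldr cancel_cons u v) =
    foldr cancel_cons (map (letter_shift p) u) (map (letter_shift p) v)"
proof (induction u)
  case (Cons a u)
  have "map (letter_shift p) (cancel_cons a w) = cancel_cons (letter_shift p a) (map (letter_shift p) w)" for w
    by (cases w) (auto simp flip: letter_shift_inv)
  then show ?case using Cons by simp
qed simp

lemma map_letter_shift_inv: "map (letter_shift p) (word_inv u) = word_inv (map (letter_shift p) u)"
  by (simp add: word_inv_def letter_shift_inv flip: rev_map)

lemma eval_word_map: "eval_word G m (map f u) = eval_word G (m \<circ> f) u"
  by (induction u) auto

text \<open>
  The generators of both epimorphisms together, the renamed relators \<open>R\<close>, and one relator that equates each
  letter \<open>a\<close> of the first group with a word \<open>t a\<close> in the second one present \<open>G\<close> again. So a word is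
  trivial if and only if no two-colouring that is invariant under these finitely many relators
  separates it from the empty word; the indicator of the kernel separates the nontrivial ones.
  Recursive enumerability of the word problem is thereby reduced to the same refutation of colourings
  that serves for subshifts.
\<close>

lemma presentation_colouring:
  assumes group: "group G" and epi: "\<phi> \<in> epi (free_group p) G"
    and hom: "\<psi> \<in> epi (free_group q) G"
    and R: "finite R" "R \<subseteq> carrier (free_group q)" "kernel (free_group q) G \<psi> = normal_closure (free_group q) R"
  obtains Z :: "letter list set" where "finite Z"
    "\<And>u. u \<in> carrier (free_group p) \<Longrightarrow>
      u \<in> word_problem p G \<phi> \<longleftrightarrow> (\<forall>Y. range Y \<subseteq> {..<2} \<and> invariant_under Z Y \<longrightarrow> Y u = Y [])"
proof -
  interpret group G by fact
  interpret F: group "free_group q" by (rule group_free_group)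
  have \<phi>: "\<phi> \<in> hom (free_group p) G" "\<phi> ` carrier (free_group p) = carrier G"
    and \<psi>: "\<psi> \<in> hom (free_group q) G" "\<psi> ` carrier (free_group q) = carrier G"
    using epi hom by (auto simp: epi_def)
  have closed: "\<phi> u \<in> carrier G" if "u \<in> carrier (free_group p)" for u using \<phi>(2) that by blast
  have closed': "\<psi> u \<in> carrier G" if "u \<in> carrier (free_group q)" for u using \<psi>(2) that by blast
  have "\<forall>a. \<exists>v. fst a < p \<longrightarrow> v \<in> carrier (free_group q) \<and> \<psi> v = \<phi> [a]"
  proof (intro allI)
    fix a :: letter
    show "\<exists>v. fst a < p \<longrightarrow> v \<in> carrier (free_group q) \<and> \<psi> v = \<phi> [a]"
    proof (cases "fst a < p")
      case True
      then have "\<phi> [a] \<in> \<psi> ` carrier (free_group q)" using \<psi>(2) closed by simp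
      then show ?thesis by (metis imageE)
    qed simp
  qed
  then obtain t where t: "\<And>a. fst a < p \<Longrightarrow> t a \<in> carrier (free_group q)" "\<And>a. fst a < p \<Longrightarrow> \<psi> (t a) = \<phi> [a]"
    by metis
  let ?s = "map (letter_shift p)"
  define Z where "Z = cancelling_pairs (p + q) \<union> ?s ` R \<union> (\<lambda>a. letter_inv a # ?s (t a)) ` ({..<p} \<times> UNIV)"
  have fin: "finite Z" using R(1) by (simp add: Z_def finite_cancelling_pairs)
  define m where "m a = (if fst a < p then \<phi> [a] else if fst a < p + q then \<psi> [(fst a - p, snd a)] else \<one>\<^bsub>G\<^esub>)" for a
  have m: "m a \<in> carrier G" for a by (auto simp: m_def intro!: closed closed')
  have m_inv: "m (letter_inv a) = inv\<^bsub>G\<^esub> (m a)" for a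
    using hom_letter_inv[OF group \<phi>(1), of a] hom_letter_inv[OF group \<psi>(1), of "(fst a - p, snd a)"]
    by (auto simp: m_def letter_inv_def)
  have eval_p: "eval_word G m u = \<phi> u" if "u \<in> carrier (free_group p)" for u
    by (rule hom_eq_eval_word[OF group \<phi>(1) _ that]) (simp add: m_def)
  have eval_q: "eval_word G m (?s u) = \<psi> u" if "u \<in> carrier (free_group q)" for u
    unfolding eval_word_map by (rule hom_eq_eval_word[OF group \<psi>(1) _ that]) (simp add: m_def letter_shift_def)
  have closed_m: "eval_word G m u \<in> carrier G" for u by (rule eval_word_closed[where m = m, OF group m m_inv])
  have append_m: "eval_word G m (u @ v) = eval_word G m u \<otimes>\<^bsub>G\<^esub> eval_word G m v" for u v
    by (rule eval_word_append[where m = m, OF group m m_inv])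
  have reduce_m: "eval_word G m (foldr cancel_cons u v) = eval_word G m u \<otimes>\<^bsub>G\<^esub> eval_word G m v" for u v
    by (rule eval_word_reduce[where m = m, OF group m m_inv])
  have kernel: "\<psi> v = \<one>\<^bsub>G\<^esub> \<longleftrightarrow> v \<in> normal_closure (free_group q) R" if "v \<in> carrier (free_group q)" for v
    using R(3) that by (auto simp: kernel_def)
  have \<psi>R: "\<psi> r = \<one>\<^bsub>G\<^esub>" if r: "r \<in> R" for r
  proof -
    have rc: "r \<in> carrier (free_group q)" using R(2) r by blast
    have "\<one>\<^bsub>free_group q\<^esub> \<otimes>\<^bsub>free_group q\<^esub> r \<otimes>\<^bsub>free_group q\<^esub> inv\<^bsub>free_group q\<^esub> \<one>\<^bsub>free_group q\<^esub> = r"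
      using rc by (simp only: F.inv_one F.l_one F.r_one)
    then have "r \<in> normal_closure (free_group q) R"
      unfolding normal_closure_def using r F.one_closed
      by (intro generate.incl) (metis (mono_tags, lifting) mem_Collect_eq)
    then show ?thesis using kernel rc by blast
  qed
  have eval_Z: "eval_word G m z = \<one>\<^bsub>G\<^esub>" if z: "z \<in> Z" for z
  proof -
    consider a where "z = [a, letter_inv a]" | r where "r \<in> R" "z = ?s r"
      | a where "fst a < p" "z = letter_inv a # ?s (t a)"
      using z unfolding Z_def cancelling_pairs_def by auto
    then show ?thesis
    proof cases
      case 1
      then show ?thesis using m by (simp add: m_inv)
    next
      case 2
      then show ?thesis using eval_q R(2) \<psi>R by auto
    next
      case 3
      then have "m a = \<phi> [a]" by (simp add: m_def)
      then show ?thesis using 3 eval_q[OF t(1)] t(2) m[of a] by (simp add: m_inv)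
    qed
  qed
  have sound: "u \<in> word_problem p G \<phi>"
    if u: "u \<in> carrier (free_group p)"
      and all: "\<forall>Y. range Y \<subseteq> {..<2} \<and> invariant_under Z Y \<longrightarrow> Y u = Y []" for u
  proof -
    define Y where "Y v = (of_bool (eval_word G m v = \<one>\<^bsub>G\<^esub>) :: nat)" for v
    have "invariant_under Z Y"
      by (auto simp: invariant_under_def Y_def append_m eval_Z closed_m)
    moreover have "range Y \<subseteq> {..<2}" by (auto simp: Y_def)
    ultimately have "Y u = Y []" using all by blast
    then have "\<phi> u = \<one>\<^bsub>G\<^esub>" using eval_p[OF u] by (auto simp: Y_def of_bool_def split: if_splits)
    then show ?thesis using u by (simp add: word_problem_def kernel_def)
  qed
  have complete: "Y u = Y []" if u: "u \<in> word_problem p G \<phi>" and inv: "invariant_under Z Y" for u Y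
  proof -
    have uc: "u \<in> carrier (free_group p)" and u1: "\<phi> u = \<one>\<^bsub>G\<^esub>" using u by (auto simp: word_problem_def kernel_def)
    have pairs: "invariant_under (cancelling_pairs (p + q)) Y"
      and RY: "\<And>r. r \<in> R \<Longrightarrow> interchangeable Y (?s r) []"
      using inv unfolding invariant_under_iff Z_def by blast+
    have tY: "interchangeable Y (letter_inv a # ?s (t a)) []" if "fst a < p" for a
    proof -
      have "a \<in> {..<p} \<times> UNIV" using that by (cases a) auto
      then show ?thesis using inv unfolding invariant_under_iff Z_def by blast
    qed
    have small: "fst ` set (?s v) \<subseteq> {..<p + q}" if "fst ` set v \<subseteq> {..<q}" for v
      using that by (auto simp: image_subset_iff)
    have reduce: "interchangeable Y (?s (foldr cancel_cons v w)) (?s v @ ?s w)" if "fst ` set v \<subseteq> {..<q}" for v w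
      unfolding map_letter_shift_reduce by (rule interchangeable_reduce[OF pairs small[OF that]])
    have conjugate: "v \<in> carrier (free_group q) \<and> interchangeable Y (?s v) []"
      if v: "v \<in> {h \<otimes>\<^bsub>free_group q\<^esub> r \<otimes>\<^bsub>free_group q\<^esub> inv\<^bsub>free_group q\<^esub> h | h r. h \<in> carrier (free_group q) \<and> r \<in> R}" for v
    proof -
      obtain h r where h: "h \<in> carrier (free_group q)" and r: "r \<in> R"
        and v: "v = h \<otimes>\<^bsub>free_group q\<^esub> r \<otimes>\<^bsub>free_group q\<^esub> inv\<^bsub>free_group q\<^esub> h"
        using v by blast
      have rc: "r \<in> carrier (free_group q)" using R(2) r by blast
      have hr: "foldr cancel_cons h r \<in> carrier (free_group q)"
        using h rc F.m_closed[of h r] by simp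
      have v': "v = foldr cancel_cons (foldr cancel_cons h r) (word_inv h)"
        using v inv_free_group(1)[OF h] by simp
      have sub: "fst ` set h \<subseteq> {..<q}" "fst ` set (foldr cancel_cons h r) \<subseteq> {..<q}"
        using h hr by (simp_all add: carrier_free_group)
      have "interchangeable Y (?s v) (?s (foldr cancel_cons h r) @ ?s (word_inv h))"
        unfolding v' by (rule reduce[OF sub(2)])
      also have "interchangeable Y \<dots> ((?s h @ ?s r) @ ?s (word_inv h))"
        by (intro interchangeable_append interchangeable_refl reduce[OF sub(1)])
      also have "interchangeable Y \<dots> ((?s h @ []) @ ?s (word_inv h))"
        by (intro interchangeable_append interchangeable_refl RY[OF r])
      also have "interchangeable Y \<dots> []"
        using interchangeable_inv'[OF pairs small[OF sub(1)]] by (simp add: map_letter_shift_inv)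
      finally show ?thesis using v h rc F.m_closed F.inv_closed by (simp del: free_group_simps)
    qed
    have normal: "v \<in> carrier (free_group q) \<and> interchangeable Y (?s v) []"
      if "v \<in> normal_closure (free_group q) R" for v
      using that unfolding normal_closure_def
    proof (induction v rule: generate.induct)
      case one
      then show ?case by simp
    next
      case (incl v)
      then show ?case by (rule conjugate)
    next
      case (inv v)
      then have v: "v \<in> carrier (free_group q)" "interchangeable Y (?s v) []" using conjugate by blast+
      have "interchangeable Y (word_inv (?s v) @ []) (word_inv (?s v) @ ?s v)"
        by (intro interchangeable_append interchangeable_refl interchangeable_sym[OF v(2)])
      also have "interchangeable Y \<dots> []"
        using v(1) by (intro interchangeable_inv[OF pairs] small) (simp add: carrier_free_group)
      finally show ?case
        using inv_free_group[OF v(1)] by (simp add: map_letter_shift_inv)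
    next
      case (eng v w)
      then have sub: "fst ` set v \<subseteq> {..<q}" by (simp add: carrier_free_group)
      have "interchangeable Y (?s (foldr cancel_cons v w)) (?s v @ ?s w)" by (rule reduce[OF sub])
      also have "interchangeable Y \<dots> ([] @ [])" using eng by (intro interchangeable_append) auto
      finally show ?case using eng reduce_carrier[OF sub] by simp
    qed
    have letter: "interchangeable Y [a] (?s (t a))" if a: "fst a < p" for a
    proof -
      have "interchangeable Y ([a] @ []) ([a] @ letter_inv a # ?s (t a))"
        by (intro interchangeable_append interchangeable_refl interchangeable_sym[OF tY[OF a]])
      also have "interchangeable Y \<dots> ([] @ ?s (t a))"
        using interchangeable_append[OF interchangeable_pair[OF pairs, of a] interchangeable_refl, of "?s (t a)"] a
        by simp
      finally show ?thesis by simp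
    qed
    have word: "interchangeable Y v (?s (concat (map t v)))" if "fst ` set v \<subseteq> {..<p}" for v
      using that
    proof (induction v)
      case (Cons a v)
      then show ?case using interchangeable_append[OF letter[of a], of v "?s (concat (map t v))"] by simp
    qed simp
    have eval_concat: "eval_word G m (?s (concat (map t v))) = eval_word G m v \<and> fst ` set (concat (map t v)) \<subseteq> {..<q}"
      if "fst ` set v \<subseteq> {..<p}" for v
      using that
    proof (induction v)
      case (Cons a v)
      have a: "fst a < p" using Cons.prems by simp
      have "m a = \<phi> [a]" using a by (simp add: m_def)
      then show ?case
        using Cons a eval_q[OF t(1)[OF a]] t(2)[OF a] t(1)[OF a] by (auto simp: append_m carrier_free_group)
    qed simp
    have up: "fst ` set u \<subseteq> {..<p}" using uc by (simp add: carrier_free_group)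
    define v where "v = concat (map t u)"
    have v: "eval_word G m (?s v) = \<one>\<^bsub>G\<^esub>" "fst ` set v \<subseteq> {..<q}"
      using eval_concat[OF up] eval_p[OF uc] u1 by (simp_all add: v_def)
    have vc: "foldr cancel_cons v [] \<in> carrier (free_group q)" using v(2) by (intro reduce_carrier) auto
    have "eval_word G m (?s (foldr cancel_cons v [])) = \<one>\<^bsub>G\<^esub>"
      unfolding map_letter_shift_reduce reduce_m by (simp add: v(1))
    then have "\<psi> (foldr cancel_cons v []) = \<one>\<^bsub>G\<^esub>" using eval_q[OF vc] by simp
    then have nc: "foldr cancel_cons v [] \<in> normal_closure (free_group q) R" using kernel[OF vc] by simp
    have "interchangeable Y u (?s v @ ?s [])" using word[OF up] by (simp add: v_def)
    also have "interchangeable Y \<dots> (?s (foldr cancel_cons v []))"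
      by (rule interchangeable_sym[OF reduce[OF v(2)]])
    also have "interchangeable Y \<dots> []" using normal[OF nc] by blast
    finally show ?thesis by (rule interchangeableD)
  qed
  show ?thesis by (rule that[OF fin]) (use sound complete in blast)
qed

lemma certifies_finitely_presented:
  assumes group: "group G" and epi: "\<phi> \<in> epi (free_group p) G" and fp: "finitely_presented G"
  shows "\<exists>T. certifies T (code ` word_problem p G \<phi>) {}"
proof -
  obtain q \<psi> R where "\<psi> \<in> epi (free_group q) G" "finite R" "R \<subseteq> carrier (free_group q)"
    "kernel (free_group q) G \<psi> = normal_closure (free_group q) R"
    using fp by (auto simp: finitely_presented_def)
  from presentation_colouring[OF group epi this]
  obtain Z where Z: "finite Z" "\<And>u. u \<in> carrier (free_group p) \<Longrightarrow>
      u \<in> word_problem p G \<phi> \<longleftrightarrow> (\<forall>Y. range Y \<subseteq> {..<2} \<and> invariant_under Z Y \<longrightarrow> Y u = Y [])"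
    by metis
  define P where "P n D i y \<longleftrightarrow> clash (code ` Z) i y \<or> (0 < i \<and> n < i \<and> y n = y 0)"
    for n :: nat and D :: "nat set" and i :: nat and y :: "nat \<Rightarrow> nat"
  define T where "T n i s \<longleftrightarrow> n \<in> code ` carrier (free_group p) \<and>
    (\<forall>\<sigma><2 ^ i. P n (set_decode s) i (digit 2 \<sigma>))" for n i s
  have "recursive_pred (\<lambda>t. T (pfst t) (pfst (psnd t)) (psnd (psnd t)))"
    unfolding T_def P_def
    by (intro recursive_intros pred_compose[OF pred_carrier] pred_clash pred_in_finite finite_imageI Z(1))
  moreover have "n \<in> code ` word_problem p G \<phi> \<longleftrightarrow> (\<exists>i s. set_decode s \<subseteq> {} \<and> T n i s)" for n
  proof (cases "n \<in> code ` carrier (free_group p)")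
    case True
    then obtain u where u: "n = code u" "u \<in> carrier (free_group p)" by blast
    have loc: "P n D i y'" if "\<And>k. k < i \<Longrightarrow> y k = y' k" "P n D i y" for D i y y'
    proof -
      have "clash E i y \<Longrightarrow> clash E i y'" for E by (erule clash_local[rotated]) (simp add: that(1))
      then show ?thesis using that unfolding P_def by auto
    qed
    have mono: "P n D' j y" if "i \<le> j" "D \<inter> {..<i} \<subseteq> D'" "P n D i y" for D D' i j y
    proof -
      have "clash E i y \<Longrightarrow> clash E j y" for E by (rule clash_mono[OF that(1)]) auto
      then show ?thesis using that unfolding P_def by auto
    qed
    have P: "(\<exists>i. P n {} i y) \<longleftrightarrow> \<not> invariant_under Z (\<lambda>v. y (code v)) \<or> y (code u) = y (code [])" for y
    proof -
      have "(\<exists>i. P n {} i y) \<longleftrightarrow> (\<exists>i. clash (code ` Z) i y) \<or> (\<exists>i. 0 < i \<and> n < i \<and> y n = y 0)"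
        unfolding P_def by blast
      moreover have "(\<exists>i. 0 < i \<and> n < i \<and> y n = y 0) \<longleftrightarrow> y n = y 0"
        by (auto intro: exI[of _ "Suc n"])
      ultimately show ?thesis unfolding clash_iff by (simp add: image_image u(1))
    qed
    have "(\<exists>i s. set_decode s \<subseteq> {} \<and> T n i s) \<longleftrightarrow>
        (\<exists>i s. set_decode s \<subseteq> {} \<and> (\<forall>\<sigma><2 ^ i. P n (set_decode s) i (digit 2 \<sigma>)))"
      using True by (simp add: T_def)
    also have "\<dots> \<longleftrightarrow> (\<forall>y. (\<forall>k. y k < 2) \<longrightarrow> (\<exists>i. P n {} i y))"
      by (rule oracle_certificate) (fact loc, fact mono, simp)
    also have "\<dots> \<longleftrightarrow> (\<forall>Y. range Y \<subseteq> {..<2} \<and> invariant_under Z Y \<longrightarrow> Y u = Y [])"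
    proof (intro iffI allI impI)
      fix Y :: "letter list \<Rightarrow> nat"
      assume "\<forall>y. (\<forall>k. y k < 2) \<longrightarrow> (\<exists>i. P n {} i y)" "range Y \<subseteq> {..<2} \<and> invariant_under Z Y"
      then show "Y u = Y []" using P[of "Y \<circ> decode"] by (auto simp: image_subset_iff simp del: code_Nil)
    next
      fix y :: "nat \<Rightarrow> nat"
      assume "\<forall>Y. range Y \<subseteq> {..<2} \<and> invariant_under Z Y \<longrightarrow> Y u = Y []" "\<forall>k. y k < 2"
      then show "\<exists>i. P n {} i y" unfolding P by (auto simp: image_subset_iff simp del: code_Nil)
    qed
    also have "\<dots> \<longleftrightarrow> n \<in> code ` word_problem p G \<phi>" using Z(2)[OF u(2)] u(1) by auto
    finally show ?thesis by blast
  qed (auto simp: T_def word_problem_def kernel_def)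
  ultimately show ?thesis unfolding certifies_def by blast
qed

text \<open>
  Post's theorem: one searches for a certificate of either kind. A certificate for the complement is
  accompanied by certificates that its oracle elements do belong to \<open>W\<close>.
\<close>

lemma decidable_if_certified:
  assumes F: "recursive_pred (\<lambda>n. n \<in> F)" and W: "W \<subseteq> F"
    and T: "certifies T W {}" and T': "certifies T' (F - W) W"
  shows "decidable W"
proof -
  have rec: "recursive_pred (\<lambda>t. T (pfst t) (pfst (psnd t)) (psnd (psnd t)))"
      "recursive_pred (\<lambda>t. T' (pfst t) (pfst (psnd t)) (psnd (psnd t)))"
    using T T' by (auto simp: certifies_def)
  have "s = 0" if "set_decode s \<subseteq> {}" for s using subset_decode_imp_le[of s 0] that by simp
  then have W_iff: "n \<in> W \<longleftrightarrow> (\<exists>i. T n i 0)" for n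
    using T unfolding certifies_def by (metis empty_subsetI set_decode_zero)
  have W'_iff: "n \<in> F - W \<longleftrightarrow> (\<exists>i s. set_decode s \<subseteq> W \<and> T' n i s)" for n
    using T' by (simp add: certifies_def)
  have rec_T: "recursive_pred (\<lambda>t. T (N t) (I t) 0)" if "total_recursive N" "total_recursive I" for N I
    using pred_compose[OF rec(1), of "\<lambda>t. prod_encode (N t, prod_encode (I t, 0))"] that
    by (simp add: recursive_intros)
  have rec_T': "recursive_pred (\<lambda>t. T' (N t) (I t) (S t))"
    if "total_recursive N" "total_recursive I" "total_recursive S" for N I S
    using pred_compose[OF rec(2), of "\<lambda>t. prod_encode (N t, prod_encode (I t, S t))"] that
    by (simp add: recursive_intros)
  define U where "U n m \<longleftrightarrow> n \<notin> F \<or> T n (pfst m) 0 \<or>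
    (T' n (pfst m) (pfst (psnd m)) \<and>
     (\<forall>c<pfst (psnd m). c \<in> set_decode (pfst (psnd m)) \<longrightarrow> (\<exists>k<psnd (psnd m). T c k 0)))" for n m
  have "recursive_pred (\<lambda>t. U (pfst t) (psnd t))"
    unfolding U_def by (intro recursive_intros pred_compose[OF F] rec_T rec_T')
  moreover have "\<exists>m. U n m" for n
  proof -
    consider "n \<notin> F" | "n \<in> W" | "n \<in> F - W" by blast
    then show ?thesis
    proof cases
      case 2
      then obtain i where "T n i 0" using W_iff by blast
      then show ?thesis by (intro exI[of _ "prod_encode (i, 0)"]) (simp add: U_def)
    next
      case 3
      then obtain i s where s: "set_decode s \<subseteq> W" "T' n i s" using W'_iff by blast
      then have "\<forall>c. \<exists>k. c \<in> set_decode s \<longrightarrow> T c k 0" using W_iff by blast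
      then obtain f where f: "\<And>c. c \<in> set_decode s \<Longrightarrow> T c (f c) 0" by metis
      have "\<exists>k<Suc (sum f (set_decode s)). T c k 0" if "c \<in> set_decode s" for c
        using f[OF that] member_le_sum[OF that, of f] by (auto intro!: exI[of _ "f c"] simp: less_Suc_eq_le)
      then show ?thesis using s(2)
        by (intro exI[of _ "prod_encode (i, prod_encode (s, Suc (sum f (set_decode s))))"]) (simp add: U_def)
    qed (auto simp: U_def)
  qed
  ultimately have least: "total_recursive (\<lambda>n. LEAST m. U n m)" and U: "U n (LEAST m. U n m)" for n
    by (auto intro: rec_Least LeastI_ex)
  have "n \<in> W \<longleftrightarrow> n \<in> F \<and> T n (pfst (LEAST m. U n m)) 0" for n
  proof
    assume n: "n \<in> W"
    define m where "m = (LEAST m. U n m)"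
    have "\<not> (T' n (pfst m) (pfst (psnd m)) \<and>
     (\<forall>c<pfst (psnd m). c \<in> set_decode (pfst (psnd m)) \<longrightarrow> (\<exists>k<psnd (psnd m). T c k 0)))"
    proof
      assume a: "T' n (pfst m) (pfst (psnd m)) \<and>
        (\<forall>c<pfst (psnd m). c \<in> set_decode (pfst (psnd m)) \<longrightarrow> (\<exists>k<psnd (psnd m). T c k 0))"
      then have "set_decode (pfst (psnd m)) \<subseteq> W" using W_iff set_decode_less by blast
      then have "n \<in> F - W" using a W'_iff by blast
      then show False using n by simp
    qed
    moreover have "U n m" unfolding m_def by (rule U)
    ultimately have "n \<in> F \<and> T n (pfst m) 0" using n W unfolding U_def by blast
    then show "n \<in> F \<and> T n (pfst (LEAST m. U n m)) 0" unfolding m_def .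
  qed (use W_iff in blast)
  moreover have "recursive_pred (\<lambda>n. n \<in> F \<and> T n (pfst (LEAST m. U n m)) 0)"
    by (intro recursive_intros F rec_T least)
  ultimately show ?thesis by (simp add: decidable_def recursive_pred_def)
qed

section \<open>Normally aperiodic subshifts and the word problem\<close>

theorem mainTheorem1:
  fixes G :: "('g, 'm) monoid_scheme" and p :: nat and \<phi> :: "letter list \<Rightarrow> 'g"
  assumes "group G"
    and "\<phi> \<in> epi (free_group p) G"
    and "\<exists>A S. finite A \<and> subshift G A S \<and> effectively_closed p G \<phi> A S \<and> normally_aperiodic G S"
  shows "code ` (carrier (free_group p) - word_problem p G \<phi>) \<le>\<^sub>e code ` word_problem p G \<phi> \<and>
    (finitely_presented G \<longrightarrow> decidable (code ` word_problem p G \<phi>))"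
proof -
  obtain A S L where A: "finite A" and closed: "closedin (prodiscrete G A) S"
    and L: "L \<subseteq> words p A" "recursively_enumerable (word_code ` L)" and S: "S = avoiding G \<phi> A L"
    and aperiodic: "normally_aperiodic G S"
    using assms(3) by (auto simp: effectively_closed_def)
  obtain x where x: "x \<in> S" "\<And>x'. x' \<in> S \<Longrightarrow> core G x \<subseteq> core G x' \<Longrightarrow> core G x' = core G x"
    using ex_maximal_core[OF assms(1) A closed] aperiodic unfolding normally_aperiodic_def by blast
  have fin: "finite (core G x)"
    using aperiodic x(1) by (auto simp: normally_aperiodic_def core_def)
  obtain T where "certifies T (code ` {u \<in> carrier (free_group p). \<phi> u \<notin> core G x}) (code ` word_problem p G \<phi>)"
    using certifies_outside_core[OF assms(1,2) A L _ fin] x unfolding S by blast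
  from certifies_nontrivial[OF assms(1,2) fin one_core[OF assms(1,2)] this]
  obtain T' where T': "certifies T' (code ` (carrier (free_group p) - word_problem p G \<phi>)) (code ` word_problem p G \<phi>)"
    by blast
  have "decidable (code ` word_problem p G \<phi>)" if fp: "finitely_presented G"
  proof -
    obtain T where "certifies T (code ` word_problem p G \<phi>) {}"
      using certifies_finitely_presented[OF assms(1,2) fp] by blast
    then show ?thesis
      using T' by (intro decidable_if_certified[OF pred_carrier[of p]])
        (auto simp: word_problem_def kernel_def image_set_diff[OF inj_code])
  qed
  then show ?thesis using certifies_reducible[OF T'] by blast
qed

end
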